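(* Let $(A,\alpha)$, $(B,\beta)$, $(C,\gamma)$ be Lebesgue spaces, and let $\mathfrak P\in\mathrm{Pol}(A,B)$, $\mathfrak Q\in\mathrm{Pol}(B,C)$ be absolutely continuous polymorphisms with $\mathcal M^{\triangledown}$-valued densities $p:A\times B\to\mathcal M^{\triangledown}$ and $q:B\times C\to\mathcal M^{\triangledown}$. Then the product $\mathfrak Q\circ\mathfrak P$ (defined for general polymorphisms) coincides with the polymorphism whose density is $$r(a,c)=\int_B p(a,b)*q(b,c)\,d\beta(b).$$
   Context: A Lebesgue space $(A,\alpha)$ is a space with a finite positive measure, $\alpha(A)>0$, isomorphic to a disjoint union of a finite (possibly empty) segment with Lebesgue measure and an at most countable collection of atoms. $\mathbb R^\times$ is the multiplicative group of positive reals, with coordinate $t$. $\mathcal M^{\triangledown}$ is the set of positive measures $\mu$ on $\mathbb R^\times$ with $\int d\mu<\infty$ and $\int t\,d\mu(t)<\infty$; it is closed under addition and under the convolution $\int f\,d(\mu*\nu)=\iint f(s_1s_2)\,d\mu(s_1)\,d\nu(s_2)$. A polymorphism from $(A,\alpha)$ to $(B,\beta)$ is a measure $\mathfrak P$ on $A\times B\times\mathbb R^\times$ such that the image of $\mathfrak P$ under the projection to $A$ is $\alpha$ and the image of $t\cdot\mathfrak P$ under the projection to $B$ is $\beta$. $\mathrm{Pol}(A,B)$ is the set of all polymorphisms. For measurable $M\subset A$, $N\subset B$, $\mathfrak p[M\times N]\in\mathcal M^{\triangledown}$ is the image of the restriction of $\mathfrak P$ to $M\times N\times\mathbb R^\times$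 under the projection to $\mathbb R^\times$; similarly $\mathfrak q[\cdot]$ for $\mathfrak Q$, etc. General product. Let $\mathfrak P\in\mathrm{Pol}(A,B)$, $\mathfrak Q\in\mathrm{Pol}(B,C)$. For measurable $M\subset A$ and $K\subset C$ there are measures $\mathfrak p_{M,b}$, $\mathfrak q_{b,K}\in\mathcal M^{\triangledown}$, defined for $\beta$-almost all $b\in B$, such that for every measurable $N\subset B$ one has $\mathfrak p[M\times N]=\int_N\mathfrak p_{M,b}\,d\beta(b)$ and $\mathfrak q[N\times K]=\int_N\mathfrak q_{b,K}\,d\beta(b)$. The product $\mathfrak R=\mathfrak Q\circ\mathfrak P\in\mathrm{Pol}(A,C)$ is the (well-defined) polymorphism determined by $\mathfrak r[M\times K]=\int_B\mathfrak q_{b,K}*\mathfrak p_{M,b}\,d\beta(b)$ for all measurable $M\subset A$, $K\subset C$. Absolutely continuous polymorphisms. Let $p:A\times B\to\mathcal M^{\triangledown}$ be a measurable function with $\int_B\int_{\mathbb R^\times}dp(a,b)(t)\,d\beta(b)=1$ for a.e. $a$ and $\int_A\int_{\mathbb R^\times}t\,dp(a,b)(t)\,d\alpha(a)=1$ for a.e. $b$. The polymorphism with density $p$ is the measure defined by $\mathfrak P(M\times N\times E)=\int_M\int_N p(a,b)(E)\,d\beta(b)\,d\alpha(a)$ for measurable $M\subset A$, $N\subset B$, $E\subset\mathbb R^\times$; polymorphisms of this form are called absolutely continuous. *)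

theory Defs
  imports "HOL-Probability.Probability"
begin

section \<open>Lebesgue spaces\<close>

definition sum_measure :: "'a measure \<Rightarrow> 'b measure \<Rightarrow> ('a + 'b) measure" where
  "sum_measure M N = measure_of (space M <+> space N)
     {X. X \<subseteq> space M <+> space N \<and> Inl -` X \<in> sets M \<and> Inr -` X \<in> sets N}
     (\<lambda>X. emeasure M (Inl -` X) + emeasure N (Inr -` X))"

text \<open>Isomorphism of measure spaces in the usual sense of measure theory, i.e. up to null sets.\<close>

definition isomorphic_mod0 :: "'a measure \<Rightarrow> 'b measure \<Rightarrow> bool" where
  "isomorphic_mod0 M N \<longleftrightarrow>
     (\<exists>X\<in>null_sets M. \<exists>Y\<in>null_sets N. \<exists>f.
        let M' = restrict_space M (space M - X); N' = restrict_space N (space N - Y) in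
          bij_betw f (space M') (space N') \<and>
          f \<in> M' \<rightarrow>\<^sub>M N' \<and>
          inv_into (space M') f \<in> N' \<rightarrow>\<^sub>M M' \<and>
          distr M' N' f = N')"

text \<open>The segment is empty if \<open>b < a\<close>; the atoms are indexed by \<open>I \<subseteq> \<nat>\<close>
  and have masses \<open>w\<close>. The completion makes the notion independent of whether the
  \<open>\<sigma>\<close>-algebra of \<open>M\<close> is complete, so that a segment is a Lebesgue space both with its
  Borel and with its Lebesgue measurable sets; for complete \<open>M\<close> it changes nothing.\<close>

definition lebesgue_space :: "'a measure \<Rightarrow> bool" where
  "lebesgue_space M \<longleftrightarrow>
     finite_measure M \<and> emeasure M (space M) > 0 \<and>
     (\<exists>(a::real) b (I::nat set) (w::nat \<Rightarrow> ennreal). (\<forall>i\<in>I. w i > 0) \<and>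
        isomorphic_mod0 (completion M) (sum_measure (lebesgue_on {a..b}) (point_measure I w)))"


section \<open>Measures on the multiplicative group of positive reals\<close>

definition Rpos :: "real measure" where
  "Rpos = restrict_space borel {0<..}"

definition Mtri :: "real measure set" where
  "Mtri = {\<mu>. sets \<mu> = sets Rpos \<and> emeasure \<mu> (space \<mu>) < \<infinity> \<and> (\<integral>\<^sup>+ t. ennreal t \<partial>\<mu>) < \<infinity>}"

text \<open>\<open>Mtri\<close> carries the \<open>\<sigma>\<close>-algebra generated by the evaluations
  \<open>\<mu> \<mapsto> \<mu>(E)\<close>, in analogy with \<^const>\<open>subprob_algebra\<close>.\<close>

definition Mtri_algebra :: "real measure measure" where
  "Mtri_algebra = (SUP E\<in>sets Rpos. vimage_algebra Mtri (\<lambda>\<mu>. emeasure \<mu> E) borel)"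

definition mconv :: "real measure \<Rightarrow> real measure \<Rightarrow> real measure" where
  "mconv \<mu> \<nu> = distr (\<mu> \<Otimes>\<^sub>M \<nu>) Rpos (\<lambda>(s\<^sub>1, s\<^sub>2). s\<^sub>1 * s\<^sub>2)"

text \<open>The integral of a family of measures on the positive reals, taken setwise; its total mass
  may be infinite.\<close>

definition measure_integral :: "'x measure \<Rightarrow> ('x \<Rightarrow> real measure) \<Rightarrow> real measure" where
  "measure_integral M \<kappa> =
     measure_of (space Rpos) (sets Rpos) (\<lambda>E. \<integral>\<^sup>+ x. emeasure (\<kappa> x) E \<partial>M)"

text \<open>The integral as an element of \<open>Mtri\<close>. As for \<^const>\<open>lebesgue_integral\<close>, the value is
  zero by convention if the integral does not converge in \<open>Mtri\<close>.\<close>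

definition Mtri_integral :: "'x measure \<Rightarrow> ('x \<Rightarrow> real measure) \<Rightarrow> real measure" where
  "Mtri_integral M \<kappa> =
     (if measure_integral M \<kappa> \<in> Mtri then measure_integral M \<kappa> else null_measure Rpos)"


section \<open>Polymorphisms\<close>

definition Pol :: "'a measure \<Rightarrow> 'b measure \<Rightarrow> ('a \<times> 'b \<times> real) measure set" where
  "Pol A B = {P. sets P = sets (A \<Otimes>\<^sub>M B \<Otimes>\<^sub>M Rpos) \<and>
                 distr P A (\<lambda>(a, b, t). a) = A \<and>
                 distr (density P (\<lambda>(a, b, t). ennreal t)) B (\<lambda>(a, b, t). b) = B}"

text \<open>The measure \<open>\<pp>[M \<times> N]\<close>.\<close>

definition pol_rect :: "('a \<times> 'b \<times> real) measure \<Rightarrow> 'a set \<Rightarrow> 'b set \<Rightarrow> real measure" where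
  "pol_rect P M N = distr (restrict_space P (M \<times> N \<times> space Rpos)) Rpos (\<lambda>(a, b, t). t)"

text \<open>\<open>f b\<close> and \<open>g b\<close> play the roles of \<open>\<pp>\<^bsub>M,b\<^esub>\<close> and \<open>\<qq>\<^bsub>b,K\<^esub>\<close>. Such families are determined
  only almost everywhere, so they may be taken to be defined for all \<open>b\<close>.\<close>

definition disintegrates_left ::
    "'b measure \<Rightarrow> ('a \<times> 'b \<times> real) measure \<Rightarrow> 'a set \<Rightarrow> ('b \<Rightarrow> real measure) \<Rightarrow> bool" where
  "disintegrates_left B P M f \<longleftrightarrow> f \<in> B \<rightarrow>\<^sub>M Mtri_algebra \<and>
     (\<forall>N\<in>sets B. pol_rect P M N = measure_integral (restrict_space B N) f)"

definition disintegrates_right ::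
    "'b measure \<Rightarrow> ('b \<times> 'c \<times> real) measure \<Rightarrow> 'c set \<Rightarrow> ('b \<Rightarrow> real measure) \<Rightarrow> bool" where
  "disintegrates_right B Q K g \<longleftrightarrow> g \<in> B \<rightarrow>\<^sub>M Mtri_algebra \<and>
     (\<forall>N\<in>sets B. pol_rect Q N K = measure_integral (restrict_space B N) g)"

definition is_pol_product ::
    "'a measure \<Rightarrow> 'b measure \<Rightarrow> 'c measure \<Rightarrow> ('a \<times> 'b \<times> real) measure \<Rightarrow>
     ('b \<times> 'c \<times> real) measure \<Rightarrow> ('a \<times> 'c \<times> real) measure \<Rightarrow> bool" where
  "is_pol_product A B C P Q R \<longleftrightarrow> R \<in> Pol A C \<and>
     (\<forall>M\<in>sets A. \<forall>K\<in>sets C. \<exists>f g.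
        disintegrates_left B P M f \<and> disintegrates_right B Q K g \<and>
        pol_rect R M K = measure_integral B (\<lambda>b. mconv (g b) (f b)))"

text \<open>The product \<open>Q \<circ> P\<close>.\<close>

definition pol_product ::
    "'a measure \<Rightarrow> 'b measure \<Rightarrow> 'c measure \<Rightarrow> ('b \<times> 'c \<times> real) measure \<Rightarrow>
     ('a \<times> 'b \<times> real) measure \<Rightarrow> ('a \<times> 'c \<times> real) measure" where
  "pol_product A B C Q P = (THE R. is_pol_product A B C P Q R)"


section \<open>Absolutely continuous polymorphisms\<close>

definition pol_density :: "'a measure \<Rightarrow> 'b measure \<Rightarrow> ('a \<times> 'b \<Rightarrow> real measure) \<Rightarrow> bool" where
  "pol_density A B p \<longleftrightarrow>
     p \<in> A \<Otimes>\<^sub>M B \<rightarrow>\<^sub>M Mtri_algebra \<and>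
     (AE a in A. (\<integral>\<^sup>+ b. emeasure (p (a, b)) (space Rpos) \<partial>B) = 1) \<and>
     (AE b in B. (\<integral>\<^sup>+ a. (\<integral>\<^sup>+ t. ennreal t \<partial>p (a, b)) \<partial>A) = 1)"

definition has_pol_density ::
    "'a measure \<Rightarrow> 'b measure \<Rightarrow> ('a \<times> 'b \<times> real) measure \<Rightarrow> ('a \<times> 'b \<Rightarrow> real measure) \<Rightarrow> bool" where
  "has_pol_density A B P p \<longleftrightarrow> pol_density A B p \<and>
     sets P = sets (A \<Otimes>\<^sub>M B \<Otimes>\<^sub>M Rpos) \<and>
     (\<forall>M\<in>sets A. \<forall>N\<in>sets B. \<forall>E\<in>sets Rpos.
        emeasure P (M \<times> N \<times> E) = (\<integral>\<^sup>+ a\<in>M. (\<integral>\<^sup>+ b\<in>N. emeasure (p (a, b)) E \<partial>B) \<partial>A))"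

end

theory Submission
  imports Defs
begin

text \<open>Formally the statement is an instance of Tonelli's theorem. The natural disintegrations of \<open>P\<close> and \<open>Q\<close> are
  \<open>f b = \<integral> p (a, b)\<close> over \<open>a \<in> M\<close> and \<open>g b = \<integral> q (b, c)\<close> over \<open>c \<in> K\<close>. Convolution is bilinear and commutative,
  so the integral over \<open>b\<close> of \<open>g b * f b\<close> equals the integral over \<open>M \<times> K\<close> of the integral over \<open>b\<close> of
  \<open>p (a, b) * q (b, c)\<close>, and this is what the polymorphism with the claimed density assigns to
  \<open>M \<times> K\<close> (\<open>is_pol_product_density\<close>).

  Three points need an argument. First, the integrals in question converge in \<^const>\<open>Mtri\<close> only almost
  everywhere. Mass and first moment are multiplicative under convolution, so the
  normalisations of \<open>p\<close> and \<open>q\<close> carry over to the product density (\<open>pol_density_composition\<close>) and,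
  the spaces being finite, force mass and moment to be finite outside a null set; the same argument
  applies to \<open>f\<close> and \<open>g\<close> (\<open>AE_left_marginal_in_Mtri\<close>, \<open>AE_right_marginal_in_Mtri\<close>).

  Second, the claimed product has to exist as a measure: it is the measure on \<open>A \<times> C \<times> \<real>\<close> with the
  values of the density as conditional measures over \<open>A \<times> C\<close> (\<open>ex_polymorphism_with_density\<close>).

  Third, the product is given by a definite description, so it has to be unique whatever
  disintegrations are chosen (\<open>is_pol_product_unique\<close>). A disintegration \<open>f\<close> determines the measure
  \<open>f b (dt) d\<beta>(b)\<close> on \<open>B \<times> \<real>\<close> on all rectangles, hence determines that measure, and for fixed \<open>g\<close> the
  integrated convolution is an integral against it.\<close>

section \<open>Kernels with values in the finite measures on the positive reals\<close>

lemma space_Rpos [simp]: "space Rpos = {0<..}"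
  by (simp add: Rpos_def space_restrict_space)

lemma sets_Rpos_space [simp]: "{0<..} \<in> sets Rpos"
  using sets.top[of Rpos] by simp

lemma measurable_Rpos_id [measurable]: "(\<lambda>t. t) \<in> borel_measurable Rpos"
  unfolding Rpos_def by (rule measurable_restrict_space1) simp

lemma measurable_ennreal_Rpos: "ennreal \<in> borel_measurable Rpos"
  using measurable_compose[OF measurable_Rpos_id measurable_ennreal] .

lemma measurable_times_Rpos [measurable]: "(\<lambda>(s, t). s * t) \<in> Rpos \<Otimes>\<^sub>M Rpos \<rightarrow>\<^sub>M Rpos"
proof -
  have "(\<lambda>z. fst z * snd z) \<in> borel_measurable (Rpos \<Otimes>\<^sub>M Rpos)"
    by measurable
  then have "(\<lambda>z. fst z * snd z) \<in> Rpos \<Otimes>\<^sub>M Rpos \<rightarrow>\<^sub>M restrict_space borel {0<..}"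
    by (intro measurable_restrict_space2) (auto simp: space_pair_measure)
  then show ?thesis
    by (simp add: Rpos_def[symmetric] case_prod_beta)
qed

lemma space_Mtri_algebra: "space Mtri_algebra = Mtri"
  unfolding Mtri_algebra_def by (subst space_Sup_eq_UN) auto

lemma measurable_Mtri_algebraI:
  assumes "\<And>x. x \<in> space X \<Longrightarrow> k x \<in> Mtri"
    and "\<And>E. E \<in> sets Rpos \<Longrightarrow> (\<lambda>x. emeasure (k x) E) \<in> borel_measurable X"
  shows "k \<in> X \<rightarrow>\<^sub>M Mtri_algebra"
  using assms unfolding Mtri_algebra_def
  by (auto intro!: measurable_Sup2 measurable_vimage_algebra2)

lemma measurable_emeasure_Mtri_algebra:
  assumes "E \<in> sets Rpos"
  shows "(\<lambda>\<mu>. emeasure \<mu> E) \<in> borel_measurable Mtri_algebra"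
  unfolding Mtri_algebra_def using assms
  by (auto intro!: measurable_Sup1 measurable_vimage_algebra1)

lemma measurable_emeasure_kernel:
  assumes "k \<in> X \<rightarrow>\<^sub>M Mtri_algebra" "E \<in> sets Rpos"
  shows "(\<lambda>x. emeasure (k x) E) \<in> borel_measurable X"
  using measurable_compose[OF assms(1) measurable_emeasure_Mtri_algebra[OF assms(2)]] .

lemma kernel_in_Mtri:
  assumes "k \<in> X \<rightarrow>\<^sub>M Mtri_algebra" "x \<in> space X"
  shows "k x \<in> Mtri"
  using measurable_space[OF assms] by (simp add: space_Mtri_algebra)

lemma Mtri_sets: "\<mu> \<in> Mtri \<Longrightarrow> sets \<mu> = sets Rpos"
  and Mtri_space: "\<mu> \<in> Mtri \<Longrightarrow> space \<mu> = {0<..}"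
  and Mtri_finite_measure: "\<mu> \<in> Mtri \<Longrightarrow> finite_measure \<mu>"
  by (auto simp: Mtri_def less_top dest: sets_eq_imp_space_eq intro!: finite_measureI)

text \<open>Dividing each \<open>k x\<close> by its total mass gives a kernel of subprobability measures, for which the
  Giry monad supplies the measurability; multiplying by the mass afterwards recovers the integral.
  Where the mass is \<open>0\<close> the factor is infinite, but it multiplies the null measure.\<close>

lemma measurable_nn_integral_kernel:
  assumes k: "k \<in> X \<rightarrow>\<^sub>M Mtri_algebra" and F: "F \<in> borel_measurable (X \<Otimes>\<^sub>M Rpos)"
  shows "(\<lambda>x. \<integral>\<^sup>+ t. F (x, t) \<partial>k x) \<in> borel_measurable X"
proof -
  define m where "m x = emeasure (k x) {0<..}" for x
  define k' where "k' x = scale_measure (inverse (m x)) (k x)" for x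
  have m [measurable]: "m \<in> borel_measurable X"
    unfolding m_def by (rule measurable_emeasure_kernel[OF k sets_Rpos_space])
  have m_finite: "m x < top" if "x \<in> space X" for x
    using kernel_in_Mtri[OF k that] by (auto simp: m_def Mtri_def Mtri_space[OF kernel_in_Mtri[OF k that]])
  have sets_k: "sets (k x) = sets Rpos" if "x \<in> space X" for x
    using kernel_in_Mtri[OF k that] by (rule Mtri_sets)
  have "k' \<in> X \<rightarrow>\<^sub>M subprob_algebra Rpos"
  proof (rule measurable_subprob_algebra)
    fix x assume x: "x \<in> space X"
    show "sets (k' x) = sets Rpos"
      using sets_k[OF x] by (simp add: k'_def)
    show "subprob_space (k' x)"
    proof (rule subprob_spaceI)
      have "space (k' x) = {0<..}"
        using Mtri_space[OF kernel_in_Mtri[OF k x]] by (simp add: k'_def space_scale_measure)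
      then have "space (k' x) = {0<..}" .
      moreover have "inverse (m x) * m x \<le> 1"
        using m_finite[OF x]
        by (cases "m x = 0") (auto simp: mult.commute[of "inverse _"] divide_ennreal_def[symmetric] ennreal_divide_self)
      ultimately show "space (k' x) \<noteq> {}" "emeasure (k' x) (space (k' x)) \<le> 1"
        by (auto simp: k'_def m_def intro: exI[of _ "1::real"])
    qed
  next
    fix E assume E: "E \<in> sets Rpos"
    show "(\<lambda>x. emeasure (k' x) E) \<in> borel_measurable X"
      unfolding k'_def using measurable_emeasure_kernel[OF k E] by simp
  qed
  note k' = this
  have "(\<lambda>x. m x * (\<integral>\<^sup>+ t. F (x, t) \<partial>k' x)) \<in> borel_measurable X"
    by (intro borel_measurable_times_ennreal m nn_integral_measurable_subprob_algebra2[OF _ k']) (use F in simp)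
  also have "?this \<longleftrightarrow> ?thesis"
  proof (rule measurable_cong)
    fix x assume x: "x \<in> space X"
    have "(\<lambda>t. F (x, t)) \<in> borel_measurable Rpos"
      using measurable_compose[OF measurable_Pair1'[OF x] F] .
    then have Fx: "(\<lambda>t. F (x, t)) \<in> borel_measurable (k x)"
      using sets_k[OF x] by (simp cong: measurable_cong_sets)
    show "m x * (\<integral>\<^sup>+ t. F (x, t) \<partial>k' x) = (\<integral>\<^sup>+ t. F (x, t) \<partial>k x)"
    proof (cases "m x = 0")
      case True
      then have "emeasure (k x) (space (k x)) = 0"
        by (simp add: m_def Mtri_space[OF kernel_in_Mtri[OF k x]])
      then have "(\<integral>\<^sup>+ t. F (x, t) \<partial>k x) = 0"
        by (simp add: Fx nn_integral_0_iff_AE emeasure_0_AE)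
      then show ?thesis using True by simp
    next
      case False
      then have "m x * inverse (m x) = 1"
        using m_finite[OF x] by (simp add: divide_ennreal_def[symmetric] ennreal_divide_self)
      then show ?thesis
        by (simp add: k'_def nn_integral_scale_measure[OF Fx] mult.assoc[symmetric])
    qed
  qed
  finally show ?thesis .
qed

section \<open>Mixtures of kernels\<close>

text \<open>Besides measures on the positive reals, mixtures are needed on \<open>X \<times> \<real>\<close>, where they record
  the parameter along with the value; hence the arbitrary target space \<open>N\<close>.\<close>

definition kernel_mixture :: "'x measure \<Rightarrow> 'y measure \<Rightarrow> ('x \<Rightarrow> 'y measure) \<Rightarrow> 'y measure" where
  "kernel_mixture X N k = measure_of (space N) (sets N) (\<lambda>E. \<integral>\<^sup>+ x. emeasure (k x) E \<partial>X)"

lemma measure_integral_eq_kernel_mixture: "measure_integral X k = kernel_mixture X Rpos k"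
  by (simp add: measure_integral_def kernel_mixture_def)

lemma sets_kernel_mixture [simp]: "sets (kernel_mixture X N k) = sets N"
  and space_kernel_mixture [simp]: "space (kernel_mixture X N k) = space N"
  by (simp_all add: kernel_mixture_def sets.sets_measure_of_eq)

lemma emeasure_kernel_mixture:
  assumes sets: "\<And>x. x \<in> space X \<Longrightarrow> sets (k x) = sets N"
    and meas: "\<And>E. E \<in> sets N \<Longrightarrow> (\<lambda>x. emeasure (k x) E) \<in> borel_measurable X"
    and E: "E \<in> sets N"
  shows "emeasure (kernel_mixture X N k) E = (\<integral>\<^sup>+ x. emeasure (k x) E \<partial>X)"
proof (rule emeasure_measure_of[OF kernel_mixture_def])
  show "sets N \<subseteq> Pow (space N)" by (rule sets.space_closed)
  show "positive (sets (kernel_mixture X N k)) (\<lambda>E. \<integral>\<^sup>+ x. emeasure (k x) E \<partial>X)"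
    by (simp add: positive_def)
  show "countably_additive (sets (kernel_mixture X N k)) (\<lambda>E. \<integral>\<^sup>+ x. emeasure (k x) E \<partial>X)"
  proof (rule countably_additiveI)
    fix D :: "nat \<Rightarrow> _"
    assume D: "range D \<subseteq> sets (kernel_mixture X N k)" "disjoint_family D"
    then have "(\<Sum>i. \<integral>\<^sup>+ x. emeasure (k x) (D i) \<partial>X) = (\<integral>\<^sup>+ x. (\<Sum>i. emeasure (k x) (D i)) \<partial>X)"
      by (intro nn_integral_suminf[symmetric] meas) auto
    also have "\<dots> = (\<integral>\<^sup>+ x. emeasure (k x) (\<Union>i. D i) \<partial>X)"
      using D by (intro nn_integral_cong suminf_emeasure) (auto simp: sets)
    finally show "(\<Sum>i. \<integral>\<^sup>+ x. emeasure (k x) (D i) \<partial>X) = (\<integral>\<^sup>+ x. emeasure (k x) (\<Union>i. D i) \<partial>X)" .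
  qed
qed (simp add: E)

lemma nn_integral_kernel_mixture:
  assumes sets: "\<And>x. x \<in> space X \<Longrightarrow> sets (k x) = sets N"
    and meas: "\<And>E. E \<in> sets N \<Longrightarrow> (\<lambda>x. emeasure (k x) E) \<in> borel_measurable X"
    and f: "f \<in> borel_measurable N"
  shows "(\<integral>\<^sup>+ y. f y \<partial>kernel_mixture X N k) = (\<integral>\<^sup>+ x. \<integral>\<^sup>+ y. f y \<partial>k x \<partial>X)"
proof -
  have M: "g \<in> borel_measurable (k x)" if "g \<in> borel_measurable N" "x \<in> space X" for g :: "_ \<Rightarrow> ennreal" and x
    using that sets[OF that(2)] by (simp cong: measurable_cong_sets)
  have M': "g \<in> borel_measurable (kernel_mixture X N k)" if "g \<in> borel_measurable N" for g :: "_ \<Rightarrow> ennreal"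
    using that by (simp cong: measurable_cong_sets)
  \<comment> \<open>It suffices to know the inner integral as some measurable function \<open>H\<close> with the right integral.\<close>
  have step: "(\<lambda>x. \<integral>\<^sup>+ y. h y \<partial>k x) \<in> borel_measurable X \<and>
      (\<integral>\<^sup>+ y. h y \<partial>kernel_mixture X N k) = (\<integral>\<^sup>+ x. \<integral>\<^sup>+ y. h y \<partial>k x \<partial>X)"
    if "\<And>x. x \<in> space X \<Longrightarrow> (\<integral>\<^sup>+ y. h y \<partial>k x) = H x" "H \<in> borel_measurable X"
      "(\<integral>\<^sup>+ y. h y \<partial>kernel_mixture X N k) = (\<integral>\<^sup>+ x. H x \<partial>X)" for h :: "_ \<Rightarrow> ennreal" and H
    using measurable_cong[THEN iffD2, OF that(1,2)] trans[OF that(3) nn_integral_cong[OF that(1)[symmetric]]]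
    by (rule conjI)
  have "(\<lambda>x. \<integral>\<^sup>+ y. f y \<partial>k x) \<in> borel_measurable X \<and>
    (\<integral>\<^sup>+ y. f y \<partial>kernel_mixture X N k) = (\<integral>\<^sup>+ x. \<integral>\<^sup>+ y. f y \<partial>k x \<partial>X)"
    using f
  proof (induction f rule: borel_measurable_induct)
    case (cong f g)
    have "(\<integral>\<^sup>+ y. f y \<partial>k x) = (\<integral>\<^sup>+ y. g y \<partial>k x)" if "x \<in> space X" for x
      using cong(3) sets_eq_imp_space_eq[OF sets[OF that]] by (intro nn_integral_cong) auto
    moreover have "(\<integral>\<^sup>+ y. f y \<partial>kernel_mixture X N k) = (\<integral>\<^sup>+ y. g y \<partial>kernel_mixture X N k)"
      using cong(3) by (intro nn_integral_cong) auto
    ultimately show ?case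
      using cong(4) by (intro step[of f "\<lambda>x. \<integral>\<^sup>+ y. g y \<partial>k x"]) simp_all
  next
    case (set E)
    show ?case
    proof (rule step)
      show "(\<integral>\<^sup>+ y. indicator E y \<partial>k x) = emeasure (k x) E" if "x \<in> space X" for x
        using sets[OF that] set by simp
      show "(\<integral>\<^sup>+ y. indicator E y \<partial>kernel_mixture X N k) = (\<integral>\<^sup>+ x. emeasure (k x) E \<partial>X)"
        using emeasure_kernel_mixture[OF sets meas set] set by simp
    qed (rule meas[OF set])
  next
    case (mult u c)
    show ?case
    proof (rule step)
      show "(\<integral>\<^sup>+ y. c * u y \<partial>k x) = c * (\<integral>\<^sup>+ y. u y \<partial>k x)" if "x \<in> space X" for x
        by (intro nn_integral_cmult M[OF \<open>u \<in> borel_measurable N\<close> that])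
      show "(\<integral>\<^sup>+ y. c * u y \<partial>kernel_mixture X N k) = (\<integral>\<^sup>+ x. c * (\<integral>\<^sup>+ y. u y \<partial>k x) \<partial>X)"
        using mult.IH by (simp add: nn_integral_cmult M'[OF \<open>u \<in> borel_measurable N\<close>])
    qed (intro borel_measurable_times_ennreal borel_measurable_const conjunct1[OF mult.IH])
  next
    case (add u v)
    show ?case
    proof (rule step)
      show "(\<integral>\<^sup>+ y. v y + u y \<partial>k x) = (\<integral>\<^sup>+ y. v y \<partial>k x) + (\<integral>\<^sup>+ y. u y \<partial>k x)"
        if "x \<in> space X" for x
        by (intro nn_integral_add M[OF \<open>v \<in> borel_measurable N\<close> that] M[OF \<open>u \<in> borel_measurable N\<close> that])
      show "(\<integral>\<^sup>+ y. v y + u y \<partial>kernel_mixture X N k) = (\<integral>\<^sup>+ x. (\<integral>\<^sup>+ y. v y \<partial>k x) + (\<integral>\<^sup>+ y. u y \<partial>k x) \<partial>X)"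
        using add.IH
        by (simp add: nn_integral_add M'[OF \<open>v \<in> borel_measurable N\<close>] M'[OF \<open>u \<in> borel_measurable N\<close>])
    qed (intro borel_measurable_add conjunct1[OF add.IH(1)] conjunct1[OF add.IH(2)])
  next
    case (seq U)
    have U: "U i \<in> borel_measurable N" for i by fact
    show ?case
    proof (rule step)
      show "(\<integral>\<^sup>+ y. (SUP i. U i) y \<partial>k x) = (SUP i. \<integral>\<^sup>+ y. U i y \<partial>k x)" if "x \<in> space X" for x
        unfolding SUP_apply by (intro nn_integral_monotone_convergence_SUP M[OF _ that] U \<open>incseq U\<close>)
      have "(\<integral>\<^sup>+ y. (SUP i. U i) y \<partial>kernel_mixture X N k) = (SUP i. \<integral>\<^sup>+ y. U i y \<partial>kernel_mixture X N k)"
        unfolding SUP_apply by (intro nn_integral_monotone_convergence_SUP M' U \<open>incseq U\<close>)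
      also have "\<dots> = (SUP i. \<integral>\<^sup>+ x. \<integral>\<^sup>+ y. U i y \<partial>k x \<partial>X)"
        using seq.IH by simp
      also have "\<dots> = (\<integral>\<^sup>+ x. (SUP i. \<integral>\<^sup>+ y. U i y \<partial>k x) \<partial>X)"
        using seq.IH \<open>incseq U\<close>
        by (intro nn_integral_monotone_convergence_SUP[symmetric])
          (auto simp: incseq_def le_fun_def intro!: nn_integral_mono)
      finally show "(\<integral>\<^sup>+ y. (SUP i. U i) y \<partial>kernel_mixture X N k) = (\<integral>\<^sup>+ x. (SUP i. \<integral>\<^sup>+ y. U i y \<partial>k x) \<partial>X)" .
    qed (intro borel_measurable_SUP countableI_type conjunct1[OF seq.IH])
  qed
  then show ?thesis by blast
qed

section \<open>Multiplicative convolution\<close>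

lemma Mtri_iff:
  "\<mu> \<in> Mtri \<longleftrightarrow> sets \<mu> = sets Rpos \<and> emeasure \<mu> {0<..} < \<infinity> \<and> (\<integral>\<^sup>+ t. ennreal t \<partial>\<mu>) < \<infinity>"
  using sets_eq_imp_space_eq[of \<mu> Rpos] by (auto simp: Mtri_def)

lemma null_measure_in_Mtri: "null_measure Rpos \<in> Mtri"
  by (simp add: Mtri_iff)

lemma borel_measurable_Mtri:
  assumes "\<mu> \<in> Mtri" "f \<in> borel_measurable Rpos"
  shows "f \<in> borel_measurable \<mu>"
  using assms(2) Mtri_sets[OF assms(1)] by (simp cong: measurable_cong_sets)

lemma nn_integral_mconv:
  assumes \<mu>: "\<mu> \<in> Mtri" and \<nu>: "\<nu> \<in> Mtri" and f: "f \<in> borel_measurable Rpos"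
  shows "(\<integral>\<^sup>+ u. f u \<partial>mconv \<mu> \<nu>) = (\<integral>\<^sup>+ s. \<integral>\<^sup>+ t. f (s * t) \<partial>\<nu> \<partial>\<mu>)"
proof -
  interpret \<nu>: finite_measure \<nu> by (rule Mtri_finite_measure[OF \<nu>])
  have sets: "sets (\<mu> \<Otimes>\<^sub>M \<nu>) = sets (Rpos \<Otimes>\<^sub>M Rpos)"
    using \<mu> \<nu> by (intro sets_pair_measure_cong Mtri_sets)
  have times: "(\<lambda>(s, t). s * t) \<in> \<mu> \<Otimes>\<^sub>M \<nu> \<rightarrow>\<^sub>M Rpos"
    using measurable_times_Rpos sets by (simp cong: measurable_cong_sets)
  have "(\<integral>\<^sup>+ u. f u \<partial>mconv \<mu> \<nu>) = (\<integral>\<^sup>+ z. f (fst z * snd z) \<partial>(\<mu> \<Otimes>\<^sub>M \<nu>))"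
    unfolding mconv_def using times f by (subst nn_integral_distr) (auto simp: case_prod_beta)
  also have "\<dots> = (\<integral>\<^sup>+ s. \<integral>\<^sup>+ t. f (s * t) \<partial>\<nu> \<partial>\<mu>)"
    using measurable_compose[OF times f]
    by (subst \<nu>.nn_integral_fst[symmetric]) (simp_all add: case_prod_beta)
  finally show ?thesis .
qed

lemma sets_mconv [simp]: "sets (mconv \<mu> \<nu>) = sets Rpos"
  by (simp add: mconv_def)

lemma emeasure_mconv:
  assumes "\<mu> \<in> Mtri" "\<nu> \<in> Mtri" "E \<in> sets Rpos"
  shows "emeasure (mconv \<mu> \<nu>) E = (\<integral>\<^sup>+ s. \<integral>\<^sup>+ t. indicator E (s * t) \<partial>\<nu> \<partial>\<mu>)"
  using nn_integral_mconv[OF assms(1,2), of "indicator E"] assms(3) by simp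

lemma measurable_times_Rpos_compose:
  assumes "g \<in> X \<rightarrow>\<^sub>M Rpos" "h \<in> X \<rightarrow>\<^sub>M Rpos"
  shows "(\<lambda>x. g x * h x) \<in> X \<rightarrow>\<^sub>M Rpos"
  using measurable_compose[OF measurable_Pair[OF assms] measurable_times_Rpos] by simp

text \<open>The product of polymorphisms convolves in the order opposite to the one of the density \<open>r\<close>, and
  swapping the factors also reduces statements about the second one to the first.\<close>

lemma mconv_commute:
  assumes \<mu>: "\<mu> \<in> Mtri" and \<nu>: "\<nu> \<in> Mtri"
  shows "mconv \<mu> \<nu> = mconv \<nu> \<mu>"
proof (rule measure_eqI)
  fix E assume "E \<in> sets (mconv \<mu> \<nu>)"
  then have E: "E \<in> sets Rpos" by simp
  interpret \<mu>: finite_measure \<mu> by (rule Mtri_finite_measure[OF \<mu>])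
  interpret \<nu>: finite_measure \<nu> by (rule Mtri_finite_measure[OF \<nu>])
  interpret pair_sigma_finite \<mu> \<nu> ..
  have sets: "sets (\<mu> \<Otimes>\<^sub>M \<nu>) = sets (Rpos \<Otimes>\<^sub>M Rpos)"
    using \<mu> \<nu> by (intro sets_pair_measure_cong Mtri_sets)
  have "(\<lambda>z. indicator E (fst z * snd z) :: ennreal) \<in> borel_measurable (Rpos \<Otimes>\<^sub>M Rpos)"
    using measurable_compose[OF measurable_times_Rpos borel_measurable_indicator[OF E]]
    by (simp add: case_prod_beta)
  then have "(\<lambda>(s, t). indicator E (s * t) :: ennreal) \<in> borel_measurable (\<mu> \<Otimes>\<^sub>M \<nu>)"
    by (simp add: case_prod_beta sets cong: measurable_cong_sets)
  then have "(\<integral>\<^sup>+ s. \<integral>\<^sup>+ t. indicator E (s * t) \<partial>\<nu> \<partial>\<mu>) = (\<integral>\<^sup>+ t. \<integral>\<^sup>+ s. indicator E (s * t) \<partial>\<mu> \<partial>\<nu>)"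
    by (rule Fubini'[symmetric])
  then show "emeasure (mconv \<mu> \<nu>) E = emeasure (mconv \<nu> \<mu>) E"
    by (simp add: emeasure_mconv[OF \<mu> \<nu> E] emeasure_mconv[OF \<nu> \<mu> E] mult.commute)
qed simp

text \<open>Total mass and first moment are multiplicative. This is what makes both the convolution of two
  elements of \<^const>\<open>Mtri\<close> an element of it and the product density normalised.\<close>

lemma emeasure_mconv_space:
  assumes \<mu>: "\<mu> \<in> Mtri" and \<nu>: "\<nu> \<in> Mtri"
  shows "emeasure (mconv \<mu> \<nu>) {0<..} = emeasure \<mu> {0<..} * emeasure \<nu> {0<..}"
proof -
  have "emeasure (mconv \<mu> \<nu>) {0<..} = (\<integral>\<^sup>+ s. \<integral>\<^sup>+ t. indicator {0<..} (s * t) \<partial>\<nu> \<partial>\<mu>)"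
    by (rule emeasure_mconv[OF \<mu> \<nu>]) simp
  also have "\<dots> = (\<integral>\<^sup>+ s. \<integral>\<^sup>+ t. 1 \<partial>\<nu> \<partial>\<mu>)"
    by (intro nn_integral_cong) (simp add: Mtri_space[OF \<mu>] Mtri_space[OF \<nu>])
  finally show ?thesis
    by (simp add: Mtri_space[OF \<mu>] Mtri_space[OF \<nu>] mult.commute)
qed

lemma nn_integral_mconv_ennreal:
  assumes \<mu>: "\<mu> \<in> Mtri" and \<nu>: "\<nu> \<in> Mtri"
  shows "(\<integral>\<^sup>+ t. ennreal t \<partial>mconv \<mu> \<nu>) = (\<integral>\<^sup>+ t. ennreal t \<partial>\<mu>) * (\<integral>\<^sup>+ t. ennreal t \<partial>\<nu>)"
proof -
  note m = measurable_ennreal_Rpos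
  have "(\<integral>\<^sup>+ t. ennreal t \<partial>mconv \<mu> \<nu>) = (\<integral>\<^sup>+ s. \<integral>\<^sup>+ t. ennreal (s * t) \<partial>\<nu> \<partial>\<mu>)"
    by (rule nn_integral_mconv[OF \<mu> \<nu> m])
  also have "\<dots> = (\<integral>\<^sup>+ s. \<integral>\<^sup>+ t. ennreal s * ennreal t \<partial>\<nu> \<partial>\<mu>)"
    by (intro nn_integral_cong) (simp add: Mtri_space[OF \<mu>] Mtri_space[OF \<nu>] ennreal_mult)
  finally show ?thesis
    using borel_measurable_Mtri[OF \<nu> m] borel_measurable_Mtri[OF \<mu> m]
    by (simp add: nn_integral_cmult nn_integral_multc)
qed

lemma mconv_in_Mtri:
  assumes \<mu>: "\<mu> \<in> Mtri" and \<nu>: "\<nu> \<in> Mtri"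
  shows "mconv \<mu> \<nu> \<in> Mtri"
proof -
  have "emeasure \<mu> {0<..} * emeasure \<nu> {0<..} < \<infinity>"
    "(\<integral>\<^sup>+ t. ennreal t \<partial>\<mu>) * (\<integral>\<^sup>+ t. ennreal t \<partial>\<nu>) < \<infinity>"
    using \<mu> \<nu> unfolding Mtri_iff infinity_ennreal_def by (simp_all add: ennreal_mult_less_top)
  then show ?thesis
    unfolding Mtri_iff[of "mconv \<mu> \<nu>"] emeasure_mconv_space[OF \<mu> \<nu>] nn_integral_mconv_ennreal[OF \<mu> \<nu>]
    by (intro conjI sets_mconv)
qed

text \<open>As a function of \<open>(y, s)\<close>, the mass which \<open>l y\<close> gives to \<open>s\<^sup>-\<^sup>1 E\<close>: integrating it against \<open>\<mu>\<close> in
  \<open>s\<close> gives the convolution, so that \<open>(\<mu> * l y)(E)\<close> is an integral against \<open>\<mu>\<close> alone.\<close>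

lemma measurable_mconv_integrand:
  assumes l: "l \<in> Y \<rightarrow>\<^sub>M Mtri_algebra" and E: "E \<in> sets Rpos"
  shows "(\<lambda>(y, s). \<integral>\<^sup>+ t. indicator E (s * t) \<partial>l y :: ennreal) \<in> borel_measurable (Y \<Otimes>\<^sub>M Rpos)"
proof -
  have l': "(\<lambda>z. l (fst z)) \<in> Y \<Otimes>\<^sub>M Rpos \<rightarrow>\<^sub>M Mtri_algebra"
    using measurable_compose[OF measurable_fst l] .
  have "(\<lambda>z. snd (fst z) * snd z) \<in> (Y \<Otimes>\<^sub>M Rpos) \<Otimes>\<^sub>M Rpos \<rightarrow>\<^sub>M Rpos"
    by (intro measurable_times_Rpos_compose) auto
  from measurable_nn_integral_kernel[OF l' measurable_compose[OF this borel_measurable_indicator[OF E]]]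
  show ?thesis by (simp add: case_prod_beta)
qed

lemma measurable_mconv:
  assumes k: "k \<in> X \<rightarrow>\<^sub>M Mtri_algebra" and l: "l \<in> X \<rightarrow>\<^sub>M Mtri_algebra"
  shows "(\<lambda>x. mconv (k x) (l x)) \<in> X \<rightarrow>\<^sub>M Mtri_algebra"
proof (rule measurable_Mtri_algebraI)
  fix x assume "x \<in> space X"
  then show "mconv (k x) (l x) \<in> Mtri"
    by (intro mconv_in_Mtri kernel_in_Mtri[OF k] kernel_in_Mtri[OF l])
next
  fix E assume E: "E \<in> sets Rpos"
  have "(\<lambda>x. \<integral>\<^sup>+ s. \<integral>\<^sup>+ t. indicator E (s * t) \<partial>l x \<partial>k x :: ennreal) \<in> borel_measurable X"
    using measurable_nn_integral_kernel[OF k measurable_mconv_integrand[OF l E]] by simp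
  then show "(\<lambda>x. emeasure (mconv (k x) (l x)) E) \<in> borel_measurable X"
    by (subst measurable_cong[OF emeasure_mconv])
      (auto intro: kernel_in_Mtri[OF k] kernel_in_Mtri[OF l] E)
qed

section \<open>Integrals of kernels\<close>

lemma sets_measure_integral [simp]: "sets (measure_integral X k) = sets Rpos"
  and space_measure_integral [simp]: "space (measure_integral X k) = {0<..}"
  by (simp_all add: measure_integral_eq_kernel_mixture)

lemma emeasure_measure_integral:
  assumes k: "k \<in> X \<rightarrow>\<^sub>M Mtri_algebra" and E: "E \<in> sets Rpos"
  shows "emeasure (measure_integral X k) E = (\<integral>\<^sup>+ x. emeasure (k x) E \<partial>X)"
  unfolding measure_integral_eq_kernel_mixture
  by (rule emeasure_kernel_mixture[OF Mtri_sets[OF kernel_in_Mtri[OF k]] measurable_emeasure_kernel[OF k] E])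

lemma nn_integral_measure_integral:
  assumes k: "k \<in> X \<rightarrow>\<^sub>M Mtri_algebra" and f: "f \<in> borel_measurable Rpos"
  shows "(\<integral>\<^sup>+ t. f t \<partial>measure_integral X k) = (\<integral>\<^sup>+ x. \<integral>\<^sup>+ t. f t \<partial>k x \<partial>X)"
  unfolding measure_integral_eq_kernel_mixture
  by (rule nn_integral_kernel_mixture[OF Mtri_sets[OF kernel_in_Mtri[OF k]] measurable_emeasure_kernel[OF k] f])

lemma measure_integral_in_Mtri_iff:
  assumes k: "k \<in> X \<rightarrow>\<^sub>M Mtri_algebra"
  shows "measure_integral X k \<in> Mtri \<longleftrightarrow>
    (\<integral>\<^sup>+ x. emeasure (k x) {0<..} \<partial>X) < \<infinity> \<and> (\<integral>\<^sup>+ x. \<integral>\<^sup>+ t. ennreal t \<partial>k x \<partial>X) < \<infinity>"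
  by (simp add: Mtri_iff emeasure_measure_integral[OF k]
      nn_integral_measure_integral[OF k measurable_ennreal_Rpos])

text \<open>Convolution is bilinear, hence commutes with integration in both factors. Convergence of the two
  integrals enters because convolution is understood only for finite measures.\<close>

lemma mconv_measure_integral:
  assumes k: "k \<in> X \<rightarrow>\<^sub>M Mtri_algebra" and l: "l \<in> Y \<rightarrow>\<^sub>M Mtri_algebra"
    and Y: "sigma_finite_measure Y"
    and k_int: "measure_integral X k \<in> Mtri" and l_int: "measure_integral Y l \<in> Mtri"
    and E: "E \<in> sets Rpos"
  shows "emeasure (mconv (measure_integral X k) (measure_integral Y l)) E =
    (\<integral>\<^sup>+ x. \<integral>\<^sup>+ y. emeasure (mconv (k x) (l y)) E \<partial>Y \<partial>X)"
proof -
  interpret Y: sigma_finite_measure Y by (rule Y)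
  let ?h = "\<lambda>y s. \<integral>\<^sup>+ t. indicator E (s * t) \<partial>l y :: ennreal"
  have h: "(\<lambda>(y, s). ?h y s) \<in> borel_measurable (Y \<Otimes>\<^sub>M Rpos)"
    by (rule measurable_mconv_integrand[OF l E])
  have h': "(\<lambda>(s, y). ?h y s) \<in> borel_measurable (Rpos \<Otimes>\<^sub>M Y)"
    using measurable_pair_swap[OF h] by (simp add: case_prod_beta)
  have inner: "(\<integral>\<^sup>+ t. indicator E (s * t) \<partial>measure_integral Y l :: ennreal) = (\<integral>\<^sup>+ y. ?h y s \<partial>Y)"
    if "s \<in> {0<..}" for s
  proof (rule nn_integral_measure_integral[OF l])
    show "(\<lambda>t. indicator E (s * t) :: ennreal) \<in> borel_measurable Rpos"
      using that
      by (intro measurable_compose[OF _ borel_measurable_indicator[OF E]] measurable_times_Rpos_compose) auto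
  qed
  have "emeasure (mconv (measure_integral X k) (measure_integral Y l)) E =
    (\<integral>\<^sup>+ s. \<integral>\<^sup>+ y. ?h y s \<partial>Y \<partial>measure_integral X k)"
    unfolding emeasure_mconv[OF k_int l_int E] by (rule nn_integral_cong) (simp add: inner)
  also have "\<dots> = (\<integral>\<^sup>+ x. \<integral>\<^sup>+ s. \<integral>\<^sup>+ y. ?h y s \<partial>Y \<partial>k x \<partial>X)"
    using Y.borel_measurable_nn_integral_fst[OF h']
    by (intro nn_integral_measure_integral[OF k]) simp
  also have "\<dots> = (\<integral>\<^sup>+ x. \<integral>\<^sup>+ y. \<integral>\<^sup>+ s. ?h y s \<partial>k x \<partial>Y \<partial>X)"
  proof (rule nn_integral_cong)
    fix x assume x: "x \<in> space X"
    interpret kx: finite_measure "k x" by (rule Mtri_finite_measure[OF kernel_in_Mtri[OF k x]])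
    interpret pair_sigma_finite Y "k x" ..
    have "sets (Y \<Otimes>\<^sub>M k x) = sets (Y \<Otimes>\<^sub>M Rpos)"
      by (intro sets_pair_measure_cong Mtri_sets[OF kernel_in_Mtri[OF k x]] refl)
    with h have "(\<lambda>(y, s). ?h y s) \<in> borel_measurable (Y \<Otimes>\<^sub>M k x)"
      by (simp cong: measurable_cong_sets)
    then show "(\<integral>\<^sup>+ s. \<integral>\<^sup>+ y. ?h y s \<partial>Y \<partial>k x) = (\<integral>\<^sup>+ y. \<integral>\<^sup>+ s. ?h y s \<partial>k x \<partial>Y)"
      by (rule Fubini')
  qed
  also have "\<dots> = (\<integral>\<^sup>+ x. \<integral>\<^sup>+ y. emeasure (mconv (k x) (l y)) E \<partial>Y \<partial>X)"
    by (intro nn_integral_cong)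
      (simp add: emeasure_mconv[OF kernel_in_Mtri[OF k] kernel_in_Mtri[OF l] E])
  finally show ?thesis .
qed

lemma Mtri_integral_in_Mtri: "Mtri_integral X k \<in> Mtri"
  by (simp add: Mtri_integral_def null_measure_in_Mtri)

lemma measurable_moment_kernel:
  assumes k: "k \<in> X \<rightarrow>\<^sub>M Mtri_algebra"
  shows "(\<lambda>x. \<integral>\<^sup>+ t. ennreal t \<partial>k x) \<in> borel_measurable X"
  using measurable_nn_integral_kernel[OF k measurable_compose[OF measurable_snd measurable_ennreal_Rpos]]
  by simp

lemma kernel_section:
  assumes "k \<in> X \<Otimes>\<^sub>M Y \<rightarrow>\<^sub>M Z" "x \<in> space X"
  shows "(\<lambda>y. k (x, y)) \<in> Y \<rightarrow>\<^sub>M Z"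
  using measurable_compose[OF measurable_Pair1'[OF assms(2)] assms(1)] .

text \<open>The integral converges where two measurable functions of \<open>x\<close>, its mass and its moment, are finite.\<close>

lemma sets_measure_integral_in_Mtri:
  assumes Y: "sigma_finite_measure Y" and k: "k \<in> X \<Otimes>\<^sub>M Y \<rightarrow>\<^sub>M Mtri_algebra"
  shows "{x \<in> space X. measure_integral Y (\<lambda>y. k (x, y)) \<in> Mtri} \<in> sets X"
proof -
  interpret Y: sigma_finite_measure Y by (rule Y)
  have "(\<lambda>x. \<integral>\<^sup>+ y. emeasure (k (x, y)) {0<..} \<partial>Y) \<in> borel_measurable X"
    by (rule Y.borel_measurable_nn_integral_fst[OF measurable_emeasure_kernel[OF k sets_Rpos_space]])
  moreover have "(\<lambda>x. \<integral>\<^sup>+ y. \<integral>\<^sup>+ t. ennreal t \<partial>k (x, y) \<partial>Y) \<in> borel_measurable X"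
    by (rule Y.borel_measurable_nn_integral_fst[OF measurable_moment_kernel[OF k]])
  ultimately have "{x \<in> space X. (\<integral>\<^sup>+ y. emeasure (k (x, y)) {0<..} \<partial>Y) < \<infinity> \<and>
      (\<integral>\<^sup>+ y. \<integral>\<^sup>+ t. ennreal t \<partial>k (x, y) \<partial>Y) < \<infinity>} \<in> sets X"
    by measurable
  also have "?this \<longleftrightarrow> ?thesis"
    by (intro arg_cong[where f = "\<lambda>S. S \<in> sets X"] Collect_cong conj_cong refl
        measure_integral_in_Mtri_iff[OF kernel_section[OF k], symmetric])
  finally show ?thesis .
qed

lemma measurable_Mtri_integral:
  assumes Y: "sigma_finite_measure Y" and k: "k \<in> X \<Otimes>\<^sub>M Y \<rightarrow>\<^sub>M Mtri_algebra"
  shows "(\<lambda>x. Mtri_integral Y (\<lambda>y. k (x, y))) \<in> X \<rightarrow>\<^sub>M Mtri_algebra"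
proof (rule measurable_Mtri_algebraI)
  interpret Y: sigma_finite_measure Y by (rule Y)
  fix E assume E: "E \<in> sets Rpos"
  let ?S = "{x \<in> space X. measure_integral Y (\<lambda>y. k (x, y)) \<in> Mtri}"
  have "(\<lambda>x. \<integral>\<^sup>+ y. emeasure (k (x, y)) E \<partial>Y) \<in> borel_measurable X"
    by (rule Y.borel_measurable_nn_integral_fst[OF measurable_emeasure_kernel[OF k E]])
  then have "(\<lambda>x. (\<integral>\<^sup>+ y. emeasure (k (x, y)) E \<partial>Y) * indicator ?S x) \<in> borel_measurable X"
    using sets_measure_integral_in_Mtri[OF Y k]
    by (intro borel_measurable_times_ennreal borel_measurable_indicator)
  then show "(\<lambda>x. emeasure (Mtri_integral Y (\<lambda>y. k (x, y))) E) \<in> borel_measurable X"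
  proof (rule measurable_cong[THEN iffD1, rotated])
    fix x assume x: "x \<in> space X"
    show "(\<integral>\<^sup>+ y. emeasure (k (x, y)) E \<partial>Y) * indicator ?S x = emeasure (Mtri_integral Y (\<lambda>y. k (x, y))) E"
      using emeasure_measure_integral[OF kernel_section[OF k x] E] x
      by (simp add: Mtri_integral_def)
  qed
qed (rule Mtri_integral_in_Mtri)

section \<open>A kernel as a measure on the product space\<close>

text \<open>The measure \<open>k x (dt) dX(x)\<close> on \<open>X \<times> \<real>\<close>. It forgets the values of \<open>k\<close> on null sets, which is the ambiguity of a disintegration; it also serves
  to build a polymorphism from its density.\<close>

definition semidirect :: "'x measure \<Rightarrow> ('x \<Rightarrow> real measure) \<Rightarrow> ('x \<times> real) measure" where
  "semidirect X k = kernel_mixture X (X \<Otimes>\<^sub>M Rpos) (\<lambda>x. distr (k x) (X \<Otimes>\<^sub>M Rpos) (Pair x))"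

lemma sets_semidirect [simp]: "sets (semidirect X k) = sets (X \<Otimes>\<^sub>M Rpos)"
  and space_semidirect [simp]: "space (semidirect X k) = space (X \<Otimes>\<^sub>M Rpos)"
  by (simp_all add: semidirect_def)

lemma nn_integral_semidirect:
  assumes k: "k \<in> X \<rightarrow>\<^sub>M Mtri_algebra" and F: "F \<in> borel_measurable (X \<Otimes>\<^sub>M Rpos)"
  shows "(\<integral>\<^sup>+ z. F z \<partial>semidirect X k) = (\<integral>\<^sup>+ x. \<integral>\<^sup>+ t. F (x, t) \<partial>k x \<partial>X)"
proof -
  have Pair: "Pair x \<in> k x \<rightarrow>\<^sub>M X \<Otimes>\<^sub>M Rpos" if "x \<in> space X" for x
    using measurable_Pair1'[OF that, of Rpos] Mtri_sets[OF kernel_in_Mtri[OF k that]]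
    by (simp cong: measurable_cong_sets)
  have inner: "(\<integral>\<^sup>+ z. G z \<partial>distr (k x) (X \<Otimes>\<^sub>M Rpos) (Pair x)) = (\<integral>\<^sup>+ t. G (x, t) \<partial>k x)"
    if "x \<in> space X" "G \<in> borel_measurable (X \<Otimes>\<^sub>M Rpos)" for x and G :: "_ \<Rightarrow> ennreal"
    using that by (intro nn_integral_distr[OF Pair]) simp_all
  have "(\<integral>\<^sup>+ z. F z \<partial>semidirect X k) = (\<integral>\<^sup>+ x. \<integral>\<^sup>+ z. F z \<partial>distr (k x) (X \<Otimes>\<^sub>M Rpos) (Pair x) \<partial>X)"
    unfolding semidirect_def
  proof (rule nn_integral_kernel_mixture[OF _ _ F])
    fix D assume D: "D \<in> sets (X \<Otimes>\<^sub>M Rpos)"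
    show "(\<lambda>x. emeasure (distr (k x) (X \<Otimes>\<^sub>M Rpos) (Pair x)) D) \<in> borel_measurable X"
    proof (rule measurable_cong[THEN iffD2])
      show "emeasure (distr (k x) (X \<Otimes>\<^sub>M Rpos) (Pair x)) D = (\<integral>\<^sup>+ t. indicator D (x, t) \<partial>k x)"
        if "x \<in> space X" for x
        using inner[OF that borel_measurable_indicator[OF D]] D by simp
      show "(\<lambda>x. \<integral>\<^sup>+ t. indicator D (x, t) \<partial>k x :: ennreal) \<in> borel_measurable X"
        by (rule measurable_nn_integral_kernel[OF k borel_measurable_indicator[OF D]])
    qed
  qed simp
  also have "\<dots> = (\<integral>\<^sup>+ x. \<integral>\<^sup>+ t. F (x, t) \<partial>k x \<partial>X)"
    by (intro nn_integral_cong inner F)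
  finally show ?thesis .
qed

lemma emeasure_semidirect_Times:
  assumes k: "k \<in> X \<rightarrow>\<^sub>M Mtri_algebra" and N: "N \<in> sets X" and E: "E \<in> sets Rpos"
  shows "emeasure (semidirect X k) (N \<times> E) = emeasure (measure_integral (restrict_space X N) k) E"
proof -
  have NE: "N \<times> E \<in> sets (X \<Otimes>\<^sub>M Rpos)"
    using N E by simp
  have k': "k \<in> restrict_space X N \<rightarrow>\<^sub>M Mtri_algebra"
    by (rule measurable_restrict_space1[OF k])
  have "emeasure (semidirect X k) (N \<times> E) = (\<integral>\<^sup>+ x. \<integral>\<^sup>+ t. indicator (N \<times> E) (x, t) \<partial>k x \<partial>X)"
    using nn_integral_semidirect[OF k borel_measurable_indicator[OF NE]] NE by simp
  also have "\<dots> = (\<integral>\<^sup>+ x. emeasure (k x) E * indicator N x \<partial>X)"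
  proof (rule nn_integral_cong)
    fix x assume "x \<in> space X"
    then have "E \<in> sets (k x)"
      using Mtri_sets[OF kernel_in_Mtri[OF k]] E by simp
    then show "(\<integral>\<^sup>+ t. indicator (N \<times> E) (x, t) \<partial>k x) = emeasure (k x) E * indicator N x"
      by (cases "x \<in> N") (simp_all add: indicator_times)
  qed
  also have "\<dots> = (\<integral>\<^sup>+ x. emeasure (k x) E \<partial>restrict_space X N)"
    using N by (intro nn_integral_restrict_space[symmetric]) simp
  finally show ?thesis
    by (simp add: emeasure_measure_integral[OF k' E])
qed

lemma finite_measure_eqI_rectangles:
  assumes fin: "finite_measure \<mu>"
    and sets: "sets \<mu> = sets (X \<Otimes>\<^sub>M Y)" "sets \<nu> = sets (X \<Otimes>\<^sub>M Y)"
    and eq: "\<And>M N. M \<in> sets X \<Longrightarrow> N \<in> sets Y \<Longrightarrow> emeasure \<mu> (M \<times> N) = emeasure \<nu> (M \<times> N)"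
  shows "\<mu> = \<nu>"
proof (rule measure_eqI_generator_eq[OF Int_stable_pair_measure_generator[of X Y],
      where A = "\<lambda>_. space X \<times> space Y" and \<Omega> = "space X \<times> space Y"])
  show "{a \<times> b |a b. a \<in> sets X \<and> b \<in> sets Y} \<subseteq> Pow (space X \<times> space Y)"
    by (rule pair_measure_closed)
  show "emeasure \<mu> Z = emeasure \<nu> Z" if "Z \<in> {a \<times> b |a b. a \<in> sets X \<and> b \<in> sets Y}" for Z
    using that eq by auto
  show "emeasure \<mu> (space X \<times> space Y) \<noteq> \<infinity>" for i :: nat
    using finite_measure.emeasure_finite[OF fin] by simp
qed (auto simp: sets sets_pair_measure)

text \<open>Apply the two-factor case twice: for fixed \<open>M\<close> it extends the equality from \<open>N \<times> E\<close> to all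
  measurable subsets of \<open>Y \<times> Z\<close>, and then to all of \<open>X \<times> Y \<times> Z\<close>.\<close>

lemma finite_measure_eqI_boxes:
  assumes fin: "finite_measure \<mu>" and fin': "finite_measure \<nu>"
    and sets: "sets \<mu> = sets (X \<Otimes>\<^sub>M Y \<Otimes>\<^sub>M Z)" "sets \<nu> = sets (X \<Otimes>\<^sub>M Y \<Otimes>\<^sub>M Z)"
    and eq: "\<And>M N E. M \<in> sets X \<Longrightarrow> N \<in> sets Y \<Longrightarrow> E \<in> sets Z \<Longrightarrow>
      emeasure \<mu> (M \<times> N \<times> E) = emeasure \<nu> (M \<times> N \<times> E)"
  shows "\<mu> = \<nu>"
proof (rule finite_measure_eqI_rectangles[OF fin sets])
  fix M D assume M: "M \<in> sets X" and D: "D \<in> sets (Y \<Otimes>\<^sub>M Z)"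
  \<comment> \<open>For fixed \<open>M\<close>, both sides are finite measures in \<open>D\<close>.\<close>
  define slice where "slice \<rho> = distr (restrict_space \<rho> (M \<times> space (Y \<Otimes>\<^sub>M Z))) (Y \<Otimes>\<^sub>M Z) snd"
    for \<rho> :: "('a \<times> 'b \<times> 'c) measure"
  have slice: "emeasure (slice \<rho>) D' = emeasure \<rho> (M \<times> D')"
    if \<rho>: "sets \<rho> = sets (X \<Otimes>\<^sub>M Y \<Otimes>\<^sub>M Z)" and D': "D' \<in> sets (Y \<Otimes>\<^sub>M Z)" for \<rho> D'
  proof -
    have space: "space \<rho> = space X \<times> space (Y \<Otimes>\<^sub>M Z)"
      using sets_eq_imp_space_eq[OF \<rho>] by (simp add: space_pair_measure)
    have Mr: "M \<times> space (Y \<Otimes>\<^sub>M Z) \<in> sets \<rho>"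
      using M by (simp add: \<rho>)
    have sub: "M \<subseteq> space X" "D' \<subseteq> space (Y \<Otimes>\<^sub>M Z)"
      using M D' sets.sets_into_space by blast+
    have "snd \<in> \<rho> \<rightarrow>\<^sub>M Y \<Otimes>\<^sub>M Z"
      using measurable_snd \<rho> by (simp cong: measurable_cong_sets)
    then have "emeasure (slice \<rho>) D' = emeasure (restrict_space \<rho> (M \<times> space (Y \<Otimes>\<^sub>M Z)))
        (snd -` D' \<inter> space (restrict_space \<rho> (M \<times> space (Y \<Otimes>\<^sub>M Z))))"
      unfolding slice_def by (intro emeasure_distr measurable_restrict_space1 D')
    also have "snd -` D' \<inter> space (restrict_space \<rho> (M \<times> space (Y \<Otimes>\<^sub>M Z))) = M \<times> D'"
      using sub by (auto simp: space_restrict_space space)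
    also have "emeasure (restrict_space \<rho> (M \<times> space (Y \<Otimes>\<^sub>M Z))) (M \<times> D') = emeasure \<rho> (M \<times> D')"
      using sub Mr sets.Int_space_eq2[OF Mr] by (intro emeasure_restrict_space) auto
    finally show ?thesis .
  qed
  have "slice \<mu> = slice \<nu>"
  proof (rule finite_measure_eqI_rectangles)
    show "finite_measure (slice \<mu>)"
      using finite_measure.emeasure_finite[OF fin] slice[OF sets(1) sets.top]
      by (intro finite_measureI) (simp add: slice_def)
    show "sets (slice \<mu>) = sets (Y \<Otimes>\<^sub>M Z)" "sets (slice \<nu>) = sets (Y \<Otimes>\<^sub>M Z)"
      by (simp_all add: slice_def)
    show "emeasure (slice \<mu>) (N \<times> E) = emeasure (slice \<nu>) (N \<times> E)" if "N \<in> sets Y" "E \<in> sets Z" for N E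
      using that eq[OF M that] by (simp add: slice[OF sets(1)] slice[OF sets(2)])
  qed
  then show "emeasure \<mu> (M \<times> D) = emeasure \<nu> (M \<times> D)"
    using slice[OF sets(1) D] slice[OF sets(2) D] by simp
qed

section \<open>Uniqueness of the product of polymorphisms\<close>

lemma restrict_space_space_eq: "restrict_space X (space X) = X"
proof (rule measure_eqI)
  show "sets (restrict_space X (space X)) = sets X"
    using sets.sets_into_space by (fastforce simp: sets_restrict_space_iff)
  then show "emeasure (restrict_space X (space X)) E = emeasure X E"
    if "E \<in> sets (restrict_space X (space X))" for E
    using that sets.sets_into_space[of E X] by (intro emeasure_restrict_space) auto
qed

text \<open>A disintegration prescribes the integral of \<open>f\<close> over every \<open>N\<close>, that is, the mass of the semidirect
  measure on every rectangle \<open>N \<times> E\<close>.\<close>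

lemma semidirect_eqI:
  assumes f: "f \<in> X \<rightarrow>\<^sub>M Mtri_algebra" and f': "f' \<in> X \<rightarrow>\<^sub>M Mtri_algebra"
    and fin: "emeasure (measure_integral X f) {0<..} < \<infinity>"
    and eq: "\<And>N. N \<in> sets X \<Longrightarrow>
      measure_integral (restrict_space X N) f = measure_integral (restrict_space X N) f'"
  shows "semidirect X f = semidirect X f'"
proof (rule finite_measure_eqI_rectangles)
  have "emeasure (semidirect X f) (space (semidirect X f)) = emeasure (measure_integral X f) {0<..}"
    using emeasure_semidirect_Times[OF f sets.top sets_Rpos_space]
    by (simp add: space_pair_measure restrict_space_space_eq)
  with fin show "finite_measure (semidirect X f)"
    by (intro finite_measureI) simp
  show "emeasure (semidirect X f) (N \<times> E) = emeasure (semidirect X f') (N \<times> E)"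
    if "N \<in> sets X" "E \<in> sets Rpos" for N E
    unfolding emeasure_semidirect_Times[OF f that] emeasure_semidirect_Times[OF f' that] eq[OF that(1)] ..
qed simp_all

text \<open>The integrated convolution depends on \<open>f\<close> only through the semidirect measure, since it is the
  integral against that measure of a function determined by \<open>g\<close> and \<open>E\<close>.\<close>

lemma measure_integral_mconv_cong:
  assumes f: "f \<in> X \<rightarrow>\<^sub>M Mtri_algebra" and f': "f' \<in> X \<rightarrow>\<^sub>M Mtri_algebra"
    and g: "g \<in> X \<rightarrow>\<^sub>M Mtri_algebra"
    and eq: "semidirect X f = semidirect X f'"
  shows "measure_integral X (\<lambda>x. mconv (f x) (g x)) = measure_integral X (\<lambda>x. mconv (f' x) (g x))"
proof (rule measure_eqI)
  fix E assume "E \<in> sets (measure_integral X (\<lambda>x. mconv (f x) (g x)))"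
  then have E: "E \<in> sets Rpos" by simp
  let ?F = "\<lambda>(x, s). (\<integral>\<^sup>+ t. indicator E (s * t) \<partial>g x) :: ennreal"
  have *: "emeasure (measure_integral X (\<lambda>x. mconv (h x) (g x))) E = (\<integral>\<^sup>+ z. ?F z \<partial>semidirect X h)"
    if h: "h \<in> X \<rightarrow>\<^sub>M Mtri_algebra" for h
  proof -
    have "(\<integral>\<^sup>+ z. ?F z \<partial>semidirect X h) = (\<integral>\<^sup>+ x. emeasure (mconv (h x) (g x)) E \<partial>X)"
      unfolding nn_integral_semidirect[OF h measurable_mconv_integrand[OF g E]]
      by (intro nn_integral_cong)
        (simp add: emeasure_mconv[OF kernel_in_Mtri[OF h] kernel_in_Mtri[OF g] E])
    then show ?thesis
      by (simp add: emeasure_measure_integral[OF measurable_mconv[OF h g] E])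
  qed
  show "emeasure (measure_integral X (\<lambda>x. mconv (f x) (g x))) E =
      emeasure (measure_integral X (\<lambda>x. mconv (f' x) (g x))) E"
    by (simp only: *[OF f] *[OF f'] eq)
qed simp

lemma measure_integral_mconv_commute:
  assumes f: "f \<in> X \<rightarrow>\<^sub>M Mtri_algebra" and g: "g \<in> X \<rightarrow>\<^sub>M Mtri_algebra"
  shows "measure_integral X (\<lambda>x. mconv (f x) (g x)) = measure_integral X (\<lambda>x. mconv (g x) (f x))"
proof (rule measure_eqI)
  fix E assume "E \<in> sets (measure_integral X (\<lambda>x. mconv (f x) (g x)))"
  then have E: "E \<in> sets Rpos" by simp
  show "emeasure (measure_integral X (\<lambda>x. mconv (f x) (g x))) E =
      emeasure (measure_integral X (\<lambda>x. mconv (g x) (f x))) E"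
    unfolding emeasure_measure_integral[OF measurable_mconv[OF f g] E]
      emeasure_measure_integral[OF measurable_mconv[OF g f] E]
    by (intro nn_integral_cong arg_cong[where f = "\<lambda>\<mu>. emeasure \<mu> E"]
        mconv_commute kernel_in_Mtri[OF f] kernel_in_Mtri[OF g])
qed simp

lemma emeasure_pol_rect:
  assumes P: "sets P = sets (A \<Otimes>\<^sub>M B \<Otimes>\<^sub>M Rpos)"
    and M: "M \<in> sets A" and N: "N \<in> sets B" and E: "E \<in> sets Rpos"
  shows "emeasure (pol_rect P M N) E = emeasure P (M \<times> N \<times> E)"
proof -
  have box: "M \<times> N \<times> space Rpos \<in> sets P"
    using M N sets.top[of Rpos] by (simp add: P del: space_Rpos)
  have sub: "M \<subseteq> space A" "N \<subseteq> space B" "E \<subseteq> space Rpos"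
    using M N E sets.sets_into_space by blast+
  have space: "space P = space A \<times> space B \<times> space Rpos"
    using sets_eq_imp_space_eq[OF P] by (simp add: space_pair_measure)
  have "(\<lambda>(a, b, t). t) \<in> A \<Otimes>\<^sub>M B \<Otimes>\<^sub>M Rpos \<rightarrow>\<^sub>M Rpos"
    by measurable
  then have "(\<lambda>(a, b, t). t) \<in> P \<rightarrow>\<^sub>M Rpos"
    using P by (simp cong: measurable_cong_sets)
  then have "emeasure (pol_rect P M N) E = emeasure (restrict_space P (M \<times> N \<times> space Rpos))
      ((\<lambda>(a, b, t). t) -` E \<inter> space (restrict_space P (M \<times> N \<times> space Rpos)))"
    unfolding pol_rect_def by (intro emeasure_distr measurable_restrict_space1 E)
  also have "(\<lambda>(a, b, t). t) -` E \<inter> space (restrict_space P (M \<times> N \<times> space Rpos)) = M \<times> N \<times> E"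
    using sub unfolding space_restrict_space space by auto
  also have "emeasure (restrict_space P (M \<times> N \<times> space Rpos)) (M \<times> N \<times> E) = emeasure P (M \<times> N \<times> E)"
    using sub box sets.Int_space_eq2[OF box] by (intro emeasure_restrict_space) auto
  finally show ?thesis .
qed

lemma sets_pol_rect [simp]: "sets (pol_rect P M N) = sets Rpos"
  by (simp add: pol_rect_def)

lemma finite_measure_Pol:
  assumes "P \<in> Pol A B" "finite_measure A"
  shows "finite_measure P"
proof (rule finite_measureI)
  have sets: "sets P = sets (A \<Otimes>\<^sub>M B \<Otimes>\<^sub>M Rpos)" and A: "distr P A (\<lambda>(a, b, t). a) = A"
    using assms(1) by (auto simp: Pol_def)
  have "(\<lambda>(a, b, t). a) \<in> A \<Otimes>\<^sub>M B \<Otimes>\<^sub>M Rpos \<rightarrow>\<^sub>M A"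
    by measurable
  then have m: "(\<lambda>(a, b, t). a) \<in> P \<rightarrow>\<^sub>M A"
    using sets by (simp cong: measurable_cong_sets)
  have "emeasure P (space P) = emeasure (distr P A (\<lambda>(a, b, t). a)) (space A)"
    using emeasure_distr[OF m sets.top] measurable_space[OF m]
    by (simp add: Int_absorb1 subset_eq)
  then show "emeasure P (space P) \<noteq> \<infinity>"
    using finite_measure.emeasure_finite[OF assms(2)] by (simp add: A)
qed

text \<open>For given \<open>M\<close> and \<open>K\<close>, two products may be witnessed by different disintegrations. Each factor is
  exchanged in turn without changing the integrated convolution, so both products agree on all boxes
  \<open>M \<times> K \<times> E\<close>.\<close>

lemma is_pol_product_unique:
  assumes R: "is_pol_product A B C P Q R" and R': "is_pol_product A B C P Q R'"
    and fin: "finite_measure A" "finite_measure P" "finite_measure Q"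
    and P: "sets P = sets (A \<Otimes>\<^sub>M B \<Otimes>\<^sub>M Rpos)" and Q: "sets Q = sets (B \<Otimes>\<^sub>M C \<Otimes>\<^sub>M Rpos)"
  shows "R = R'"
proof (rule finite_measure_eqI_boxes)
  have RC: "R \<in> Pol A C" "R' \<in> Pol A C"
    using R R' by (auto simp: is_pol_product_def)
  show sets: "sets R = sets (A \<Otimes>\<^sub>M C \<Otimes>\<^sub>M Rpos)" "sets R' = sets (A \<Otimes>\<^sub>M C \<Otimes>\<^sub>M Rpos)"
    using RC by (auto simp: Pol_def)
  show "finite_measure R" "finite_measure R'"
    using RC finite_measure_Pol fin(1) by blast+
  fix M K E assume M: "M \<in> sets A" and K: "K \<in> sets C" and E: "E \<in> sets Rpos"
  obtain f g where fg: "disintegrates_left B P M f" "disintegrates_right B Q K g"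
      and RMK: "pol_rect R M K = measure_integral B (\<lambda>b. mconv (g b) (f b))"
    using R M K unfolding is_pol_product_def by blast
  obtain f' g' where fg': "disintegrates_left B P M f'" "disintegrates_right B Q K g'"
      and R'MK: "pol_rect R' M K = measure_integral B (\<lambda>b. mconv (g' b) (f' b))"
    using R' M K unfolding is_pol_product_def by blast
  have f: "f \<in> B \<rightarrow>\<^sub>M Mtri_algebra" and f': "f' \<in> B \<rightarrow>\<^sub>M Mtri_algebra"
    and g: "g \<in> B \<rightarrow>\<^sub>M Mtri_algebra" and g': "g' \<in> B \<rightarrow>\<^sub>M Mtri_algebra"
    using fg fg' by (simp_all add: disintegrates_left_def disintegrates_right_def)
  have ff': "semidirect B f = semidirect B f'"
  proof (rule semidirect_eqI[OF f f'])
    have "measure_integral B f = pol_rect P M (space B)"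
      using fg(1) sets.top[of B] unfolding disintegrates_left_def by (metis restrict_space_space_eq)
    then show "emeasure (measure_integral B f) {0<..} < \<infinity>"
      using finite_measure.emeasure_finite[OF fin(2)]
      by (simp add: emeasure_pol_rect[OF P M sets.top] less_top)
  qed (use fg(1) fg'(1) in \<open>simp add: disintegrates_left_def\<close>)
  have gg': "semidirect B g = semidirect B g'"
  proof (rule semidirect_eqI[OF g g'])
    have "measure_integral B g = pol_rect Q (space B) K"
      using fg(2) sets.top[of B] unfolding disintegrates_right_def by (metis restrict_space_space_eq)
    then show "emeasure (measure_integral B g) {0<..} < \<infinity>"
      using finite_measure.emeasure_finite[OF fin(3)]
      by (simp add: emeasure_pol_rect[OF Q sets.top K] less_top)
  qed (use fg(2) fg'(2) in \<open>simp add: disintegrates_right_def\<close>)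
  have "pol_rect R M K = measure_integral B (\<lambda>b. mconv (g' b) (f b))"
    unfolding RMK by (rule measure_integral_mconv_cong[OF g g' f gg'])
  also have "\<dots> = measure_integral B (\<lambda>b. mconv (f b) (g' b))"
    by (rule measure_integral_mconv_commute[OF g' f])
  also have "\<dots> = measure_integral B (\<lambda>b. mconv (f' b) (g' b))"
    by (rule measure_integral_mconv_cong[OF f f' g' ff'])
  also have "\<dots> = pol_rect R' M K"
    unfolding R'MK by (rule measure_integral_mconv_commute[OF f' g'])
  finally have "pol_rect R M K = pol_rect R' M K" .
  then show "emeasure R (M \<times> K \<times> E) = emeasure R' (M \<times> K \<times> E)"
    using emeasure_pol_rect[OF sets(1) M K E] emeasure_pol_rect[OF sets(2) M K E] by simp
qed

section \<open>Normalisation of the product density\<close>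

text \<open>Averaging in the second variable against a stochastic kernel does not change the integral of a
  function of the first. With \<open>v\<close> the mass of \<open>q\<close> this gives the normalisation of the masses of the
  product, with \<open>v\<close> the moment of \<open>p\<close> the one of its moments.\<close>

lemma nn_integral_weighted_stochastic:
  assumes Y: "sigma_finite_measure Y" and Z: "sigma_finite_measure Z"
    and u: "u \<in> borel_measurable Y" and v: "v \<in> borel_measurable (Y \<Otimes>\<^sub>M Z)"
    and v1: "AE y in Y. (\<integral>\<^sup>+ z. v (y, z) \<partial>Z) = 1"
  shows "(\<integral>\<^sup>+ z. \<integral>\<^sup>+ y. u y * v (y, z) \<partial>Y \<partial>Z) = (\<integral>\<^sup>+ y. u y \<partial>Y)"
proof -
  interpret Y: sigma_finite_measure Y by (rule Y)
  interpret Z: sigma_finite_measure Z by (rule Z)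
  interpret pair_sigma_finite Y Z ..
  have "(\<lambda>w. u (fst w) * v w) \<in> borel_measurable (Y \<Otimes>\<^sub>M Z)"
    by (intro borel_measurable_times_ennreal measurable_compose[OF measurable_fst u] v)
  also have "(\<lambda>w. u (fst w) * v w) = (\<lambda>(y, z). u y * v (y, z))"
    by auto
  finally have "(\<integral>\<^sup>+ z. \<integral>\<^sup>+ y. u y * v (y, z) \<partial>Y \<partial>Z) = (\<integral>\<^sup>+ y. \<integral>\<^sup>+ z. u y * v (y, z) \<partial>Z \<partial>Y)"
    by (rule Fubini')
  also have "\<dots> = (\<integral>\<^sup>+ y. u y * (\<integral>\<^sup>+ z. v (y, z) \<partial>Z) \<partial>Y)"
    by (intro nn_integral_cong nn_integral_cmult measurable_compose[OF measurable_Pair1' v])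
  also have "\<dots> = (\<integral>\<^sup>+ y. u y \<partial>Y)"
    by (rule nn_integral_cong_AE) (use v1 in eventually_elim, simp)
  finally show ?thesis .
qed

lemma nn_integral_rotate:
  assumes X: "sigma_finite_measure X" and Y: "sigma_finite_measure Y" and Z: "sigma_finite_measure Z"
    and H: "H \<in> borel_measurable ((X \<Otimes>\<^sub>M Z) \<Otimes>\<^sub>M Y)"
  shows "(\<integral>\<^sup>+ x. \<integral>\<^sup>+ z. \<integral>\<^sup>+ y. H ((x, z), y) \<partial>Y \<partial>Z \<partial>X) = (\<integral>\<^sup>+ y. \<integral>\<^sup>+ x. \<integral>\<^sup>+ z. H ((x, z), y) \<partial>Z \<partial>X \<partial>Y)"
proof -
  interpret X: sigma_finite_measure X by (rule X)
  interpret Y: sigma_finite_measure Y by (rule Y)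
  interpret Z: sigma_finite_measure Z by (rule Z)
  interpret XZ: pair_sigma_finite X Z ..
  interpret XZY: pair_sigma_finite "X \<Otimes>\<^sub>M Z" Y ..
  have "(\<integral>\<^sup>+ x. \<integral>\<^sup>+ z. \<integral>\<^sup>+ y. H ((x, z), y) \<partial>Y \<partial>Z \<partial>X) = (\<integral>\<^sup>+ w. \<integral>\<^sup>+ y. H (w, y) \<partial>Y \<partial>(X \<Otimes>\<^sub>M Z))"
    by (rule Z.nn_integral_fst[OF Y.borel_measurable_nn_integral_fst[OF H]])
  also have "\<dots> = (\<integral>\<^sup>+ y. \<integral>\<^sup>+ w. H (w, y) \<partial>(X \<Otimes>\<^sub>M Z) \<partial>Y)"
    by (rule XZY.Fubini[OF H, symmetric])
  also have "\<dots> = (\<integral>\<^sup>+ y. \<integral>\<^sup>+ x. \<integral>\<^sup>+ z. H ((x, z), y) \<partial>Z \<partial>X \<partial>Y)"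
    by (intro nn_integral_cong Z.nn_integral_fst[symmetric] measurable_compose[OF measurable_Pair2' H])
  finally show ?thesis .
qed

lemma measurable_composition_kernel:
  assumes p: "p \<in> A \<Otimes>\<^sub>M B \<rightarrow>\<^sub>M Mtri_algebra" and q: "q \<in> B \<Otimes>\<^sub>M C \<rightarrow>\<^sub>M Mtri_algebra"
  shows "(\<lambda>((a, c), b). mconv (p (a, b)) (q (b, c))) \<in> (A \<Otimes>\<^sub>M C) \<Otimes>\<^sub>M B \<rightarrow>\<^sub>M Mtri_algebra"
proof -
  have "(\<lambda>w. mconv (p (fst (fst w), snd w)) (q (snd w, snd (fst w)))) \<in> (A \<Otimes>\<^sub>M C) \<Otimes>\<^sub>M B \<rightarrow>\<^sub>M Mtri_algebra"
    by (intro measurable_mconv measurable_compose[OF _ p] measurable_compose[OF _ q] measurable_Pair) measurable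
  also have "(\<lambda>w. mconv (p (fst (fst w), snd w)) (q (snd w, snd (fst w)))) =
      (\<lambda>((a, c), b). mconv (p (a, b)) (q (b, c)))"
    by auto
  finally show ?thesis .
qed

text \<open>The mass of the convolution at \<open>(a, b, c)\<close> is the product of the masses of \<open>p (a, b)\<close> and
  \<open>q (b, c)\<close>; integrating over \<open>c\<close>, then over \<open>b\<close>, gives \<open>1\<close> for almost every \<open>a\<close>. For the moments
  integrate over \<open>a\<close>, then over \<open>b\<close>. The two normalisations bound the integrals of mass and moment
  over \<open>A \<times> C\<close>, so the integral defining the density converges almost everywhere and the value zero
  assigned where it diverges does not matter.\<close>

lemma
  assumes fin: "finite_measure A" "finite_measure B" "finite_measure C"
    and p_density: "pol_density A B p" and q_density: "pol_density B C q"
  shows AE_composition_in_Mtri: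
      "AE a in A. AE c in C. measure_integral B (\<lambda>b. mconv (p (a, b)) (q (b, c))) \<in> Mtri"
    and pol_density_composition:
      "pol_density A C (\<lambda>(a, c). Mtri_integral B (\<lambda>b. mconv (p (a, b)) (q (b, c))))"
proof -
  interpret A: finite_measure A by (rule fin)
  interpret B: finite_measure B by (rule fin)
  interpret C: finite_measure C by (rule fin)
  interpret AC: pair_sigma_finite A C ..
  have p: "p \<in> A \<Otimes>\<^sub>M B \<rightarrow>\<^sub>M Mtri_algebra" and q: "q \<in> B \<Otimes>\<^sub>M C \<rightarrow>\<^sub>M Mtri_algebra"
    and p1: "AE a in A. (\<integral>\<^sup>+ b. emeasure (p (a, b)) {0<..} \<partial>B) = 1"
    and p2: "AE b in B. (\<integral>\<^sup>+ a. \<integral>\<^sup>+ t. ennreal t \<partial>p (a, b) \<partial>A) = 1"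
    and q1: "AE b in B. (\<integral>\<^sup>+ c. emeasure (q (b, c)) {0<..} \<partial>C) = 1"
    and q2: "AE c in C. (\<integral>\<^sup>+ b. \<integral>\<^sup>+ t. ennreal t \<partial>q (b, c) \<partial>B) = 1"
    using p_density q_density by (auto simp: pol_density_def)
  define k where "k = (\<lambda>((a, c), b). mconv (p (a, b)) (q (b, c)))"
  have k: "k \<in> (A \<Otimes>\<^sub>M C) \<Otimes>\<^sub>M B \<rightarrow>\<^sub>M Mtri_algebra"
    unfolding k_def by (rule measurable_composition_kernel[OF p q])
  have pM: "p (a, b) \<in> Mtri" if "a \<in> space A" "b \<in> space B" for a b
    using kernel_in_Mtri[OF p] that by (simp add: space_pair_measure)
  have qM: "q (b, c) \<in> Mtri" if "b \<in> space B" "c \<in> space C" for b c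
    using kernel_in_Mtri[OF q] that by (simp add: space_pair_measure)
  define mass where "mass z = (\<integral>\<^sup>+ b. emeasure (k (z, b)) {0<..} \<partial>B)" for z
  define moment where "moment z = (\<integral>\<^sup>+ b. \<integral>\<^sup>+ t. ennreal t \<partial>k (z, b) \<partial>B)" for z
  have mass: "mass \<in> borel_measurable (A \<Otimes>\<^sub>M C)"
    unfolding mass_def
    by (rule B.borel_measurable_nn_integral_fst[OF measurable_emeasure_kernel[OF k sets_Rpos_space]])
  have moment: "moment \<in> borel_measurable (A \<Otimes>\<^sub>M C)"
    unfolding moment_def by (rule B.borel_measurable_nn_integral_fst[OF measurable_moment_kernel[OF k]])
  have mass1: "AE a in A. (\<integral>\<^sup>+ c. mass (a, c) \<partial>C) = 1"
    using p1
  proof (rule AE_mp, intro AE_I2 impI)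
    fix a assume a: "a \<in> space A" and 1: "(\<integral>\<^sup>+ b. emeasure (p (a, b)) {0<..} \<partial>B) = 1"
    have "(\<integral>\<^sup>+ c. mass (a, c) \<partial>C) = (\<integral>\<^sup>+ c. \<integral>\<^sup>+ b. emeasure (p (a, b)) {0<..} * emeasure (q (b, c)) {0<..} \<partial>B \<partial>C)"
      unfolding mass_def using a
      by (intro nn_integral_cong) (simp add: k_def emeasure_mconv_space pM qM)
    also have "\<dots> = (\<integral>\<^sup>+ b. emeasure (p (a, b)) {0<..} \<partial>B)"
      by (rule nn_integral_weighted_stochastic[OF B.sigma_finite_measure_axioms C.sigma_finite_measure_axioms
          measurable_emeasure_kernel[OF kernel_section[OF p a] sets_Rpos_space]
          measurable_emeasure_kernel[OF q sets_Rpos_space] q1])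
    finally show "(\<integral>\<^sup>+ c. mass (a, c) \<partial>C) = 1" using 1 by simp
  qed
  have moment1: "AE c in C. (\<integral>\<^sup>+ a. moment (a, c) \<partial>A) = 1"
    using q2
  proof (rule AE_mp, intro AE_I2 impI)
    fix c assume c: "c \<in> space C" and 1: "(\<integral>\<^sup>+ b. \<integral>\<^sup>+ t. ennreal t \<partial>q (b, c) \<partial>B) = 1"
    have "(\<integral>\<^sup>+ a. moment (a, c) \<partial>A) =
        (\<integral>\<^sup>+ a. \<integral>\<^sup>+ b. (\<integral>\<^sup>+ t. ennreal t \<partial>q (b, c)) * (case (b, a) of (b, a) \<Rightarrow> \<integral>\<^sup>+ t. ennreal t \<partial>p (a, b)) \<partial>B \<partial>A)"
      unfolding moment_def using c
      by (intro nn_integral_cong) (simp add: k_def nn_integral_mconv_ennreal pM qM mult.commute)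
    also have "\<dots> = (\<integral>\<^sup>+ b. \<integral>\<^sup>+ t. ennreal t \<partial>q (b, c) \<partial>B)"
    proof (rule nn_integral_weighted_stochastic[OF B.sigma_finite_measure_axioms A.sigma_finite_measure_axioms])
      show "(\<lambda>b. \<integral>\<^sup>+ t. ennreal t \<partial>q (b, c)) \<in> borel_measurable B"
        by (rule measurable_compose[OF measurable_Pair2'[OF c] measurable_moment_kernel[OF q]])
      show "(\<lambda>(b, a). \<integral>\<^sup>+ t. ennreal t \<partial>p (a, b)) \<in> borel_measurable (B \<Otimes>\<^sub>M A)"
        using measurable_pair_swap[OF measurable_moment_kernel[OF p]] by simp
    qed (use p2 in simp)
    finally show "(\<integral>\<^sup>+ a. moment (a, c) \<partial>A) = 1" using 1 by simp
  qed
  have "(\<integral>\<^sup>+ z. mass z \<partial>(A \<Otimes>\<^sub>M C)) = (\<integral>\<^sup>+ a. 1 \<partial>A)"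
    unfolding C.nn_integral_fst[OF mass, symmetric] by (rule nn_integral_cong_AE[OF mass1])
  then have mass_fin: "AE z in A \<Otimes>\<^sub>M C. mass z \<noteq> \<infinity>"
    using A.emeasure_finite by (intro nn_integral_PInf_AE mass) simp
  have "(\<integral>\<^sup>+ z. moment z \<partial>(A \<Otimes>\<^sub>M C)) = (\<integral>\<^sup>+ c. 1 \<partial>C)"
    unfolding AC.nn_integral_snd[OF moment, symmetric] by (rule nn_integral_cong_AE[OF moment1])
  then have moment_fin: "AE z in A \<Otimes>\<^sub>M C. moment z \<noteq> \<infinity>"
    using C.emeasure_finite by (intro nn_integral_PInf_AE moment) simp
  have good: "AE z in A \<Otimes>\<^sub>M C. measure_integral B (\<lambda>b. k (z, b)) \<in> Mtri"
    using mass_fin moment_fin AE_space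
  proof eventually_elim
    case (elim z)
    then show ?case
      by (simp add: measure_integral_in_Mtri_iff[OF kernel_section[OF k]] mass_def moment_def less_top)
  qed
  then have good1: "AE a in A. AE c in C. measure_integral B (\<lambda>b. k ((a, c), b)) \<in> Mtri"
    by (rule AC.AE_pair)
  moreover have "{z \<in> space (A \<Otimes>\<^sub>M C). measure_integral B (\<lambda>b. k (z, b)) \<in> Mtri} \<in> sets (A \<Otimes>\<^sub>M C)"
    by (rule sets_measure_integral_in_Mtri[OF B.sigma_finite_measure_axioms k])
  \<comment> \<open>The normalisation of the moments needs the null sets in the other order.\<close>
  ultimately have good2: "AE c in C. AE a in A. measure_integral B (\<lambda>b. k ((a, c), b)) \<in> Mtri"
    using AC.AE_commute[of "\<lambda>a c. measure_integral B (\<lambda>b. k ((a, c), b)) \<in> Mtri"]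
    by (simp add: case_prod_beta)
  show "AE a in A. AE c in C. measure_integral B (\<lambda>b. mconv (p (a, b)) (q (b, c))) \<in> Mtri"
    using good1 by (simp add: k_def)
  define r where "r z = Mtri_integral B (\<lambda>b. k (z, b))" for z
  have r_mass: "emeasure (r z) {0<..} = mass z"
    and r_moment: "(\<integral>\<^sup>+ t. ennreal t \<partial>r z) = moment z"
    if "z \<in> space (A \<Otimes>\<^sub>M C)" "measure_integral B (\<lambda>b. k (z, b)) \<in> Mtri" for z
    using that kernel_section[OF k that(1)]
    by (simp_all add: r_def Mtri_integral_def mass_def moment_def emeasure_measure_integral
        nn_integral_measure_integral measurable_ennreal_Rpos)
  have "AE a in A. (\<integral>\<^sup>+ c. emeasure (r (a, c)) {0<..} \<partial>C) = 1"
    using mass1 good1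
  proof (rule AE_mp[OF _ AE_mp], intro AE_I2 impI)
    fix a assume a: "a \<in> space A" and *: "AE c in C. measure_integral B (\<lambda>b. k ((a, c), b)) \<in> Mtri"
      and 1: "(\<integral>\<^sup>+ c. mass (a, c) \<partial>C) = 1"
    have "(\<integral>\<^sup>+ c. emeasure (r (a, c)) {0<..} \<partial>C) = (\<integral>\<^sup>+ c. mass (a, c) \<partial>C)"
      by (rule nn_integral_cong_AE) (use * AE_space in eventually_elim, simp add: r_mass a space_pair_measure)
    with 1 show "(\<integral>\<^sup>+ c. emeasure (r (a, c)) {0<..} \<partial>C) = 1" by simp
  qed
  moreover have "AE c in C. (\<integral>\<^sup>+ a. \<integral>\<^sup>+ t. ennreal t \<partial>r (a, c) \<partial>A) = 1"
    using moment1 good2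
  proof (rule AE_mp[OF _ AE_mp], intro AE_I2 impI)
    fix c assume c: "c \<in> space C" and *: "AE a in A. measure_integral B (\<lambda>b. k ((a, c), b)) \<in> Mtri"
      and 1: "(\<integral>\<^sup>+ a. moment (a, c) \<partial>A) = 1"
    have "(\<integral>\<^sup>+ a. \<integral>\<^sup>+ t. ennreal t \<partial>r (a, c) \<partial>A) = (\<integral>\<^sup>+ a. moment (a, c) \<partial>A)"
      by (rule nn_integral_cong_AE) (use * AE_space in eventually_elim, simp add: r_moment c space_pair_measure)
    with 1 show "(\<integral>\<^sup>+ a. \<integral>\<^sup>+ t. ennreal t \<partial>r (a, c) \<partial>A) = 1" by simp
  qed
  moreover have "r \<in> A \<Otimes>\<^sub>M C \<rightarrow>\<^sub>M Mtri_algebra"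
    unfolding r_def by (rule measurable_Mtri_integral[OF B.sigma_finite_measure_axioms k])
  ultimately have "pol_density A C r"
    by (simp add: pol_density_def)
  also have "r = (\<lambda>(a, c). Mtri_integral B (\<lambda>b. mconv (p (a, b)) (q (b, c))))"
    by (auto simp: r_def k_def)
  finally show "pol_density A C (\<lambda>(a, c). Mtri_integral B (\<lambda>b. mconv (p (a, b)) (q (b, c))))" .
qed

section \<open>Polymorphisms from densities\<close>

text \<open>The semidirect measure over \<open>A \<times> C\<close>, with its factors reassociated. The two normalisations of the
  density are exactly the two marginal conditions.\<close>

lemma ex_polymorphism_with_density:
  assumes fin: "finite_measure A" "finite_measure C" and r_density: "pol_density A C r"
  shows "\<exists>R \<in> Pol A C. has_pol_density A C R r"
proof -
  interpret A: finite_measure A by (rule fin)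
  interpret C: finite_measure C by (rule fin)
  interpret AC: pair_sigma_finite A C ..
  have r: "r \<in> A \<Otimes>\<^sub>M C \<rightarrow>\<^sub>M Mtri_algebra"
    and r1: "AE a in A. (\<integral>\<^sup>+ c. emeasure (r (a, c)) {0<..} \<partial>C) = 1"
    and r2: "AE c in C. (\<integral>\<^sup>+ a. \<integral>\<^sup>+ t. ennreal t \<partial>r (a, c) \<partial>A) = 1"
    using r_density by (auto simp: pol_density_def)
  have rM: "r (a, c) \<in> Mtri" if "a \<in> space A" "c \<in> space C" for a c
    using kernel_in_Mtri[OF r] that by (simp add: space_pair_measure)
  let ?X = "A \<Otimes>\<^sub>M C \<Otimes>\<^sub>M Rpos"
  define R where "R = distr (semidirect (A \<Otimes>\<^sub>M C) r) ?X (\<lambda>((a, c), t). (a, c, t))"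
  have sets_R [simp]: "sets R = sets ?X"
    by (simp add: R_def)
  have assoc: "(\<lambda>((a, c), t). (a, c, t)) \<in> (A \<Otimes>\<^sub>M C) \<Otimes>\<^sub>M Rpos \<rightarrow>\<^sub>M ?X"
  proof -
    have "(\<lambda>w. (fst (fst w), snd (fst w), snd w)) \<in> (A \<Otimes>\<^sub>M C) \<Otimes>\<^sub>M Rpos \<rightarrow>\<^sub>M ?X"
      by measurable
    also have "(\<lambda>w. (fst (fst w), snd (fst w), snd w)) = (\<lambda>((a, c), t). (a, c, t))"
      by auto
    finally show ?thesis .
  qed
  have nn_integral_R: "(\<integral>\<^sup>+ x. F x \<partial>R) = (\<integral>\<^sup>+ z. \<integral>\<^sup>+ t. F (fst z, snd z, t) \<partial>r z \<partial>(A \<Otimes>\<^sub>M C))"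
    if F: "F \<in> borel_measurable ?X" for F
  proof -
    have "(\<integral>\<^sup>+ x. F x \<partial>R) = (\<integral>\<^sup>+ w. F (fst (fst w), snd (fst w), snd w) \<partial>semidirect (A \<Otimes>\<^sub>M C) r)"
      unfolding R_def using F assoc
      by (subst nn_integral_distr) (auto simp: case_prod_beta cong: measurable_cong_sets)
    also have "\<dots> = (\<integral>\<^sup>+ z. \<integral>\<^sup>+ t. F (fst (fst (z, t)), snd (fst (z, t)), snd (z, t)) \<partial>r z \<partial>(A \<Otimes>\<^sub>M C))"
      using measurable_compose[OF assoc F] by (intro nn_integral_semidirect[OF r]) (simp add: case_prod_beta)
    finally show ?thesis by simp
  qed
  have box: "emeasure R (M \<times> N \<times> E) = (\<integral>\<^sup>+ a\<in>M. (\<integral>\<^sup>+ c\<in>N. emeasure (r (a, c)) E \<partial>C) \<partial>A)"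
    if M: "M \<in> sets A" and N: "N \<in> sets C" and E: "E \<in> sets Rpos" for M N E
  proof -
    have D: "M \<times> N \<times> E \<in> sets ?X"
      using that by simp
    have "emeasure R (M \<times> N \<times> E) = (\<integral>\<^sup>+ z. \<integral>\<^sup>+ t. indicator (M \<times> N \<times> E) (fst z, snd z, t) \<partial>r z \<partial>(A \<Otimes>\<^sub>M C))"
      using nn_integral_R[OF borel_measurable_indicator[OF D]] D by simp
    also have "\<dots> = (\<integral>\<^sup>+ z. emeasure (r z) E * indicator (M \<times> N) z \<partial>(A \<Otimes>\<^sub>M C))"
    proof (rule nn_integral_cong)
      fix z assume z: "z \<in> space (A \<Otimes>\<^sub>M C)"
      have Ez: "E \<in> sets (r z)"
        using Mtri_sets[OF kernel_in_Mtri[OF r z]] E by simp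
      have "(\<integral>\<^sup>+ t. indicator (M \<times> N \<times> E) (fst z, snd z, t) \<partial>r z)
          = (\<integral>\<^sup>+ t. indicator (M \<times> N) z * indicator E t \<partial>r z)"
        by (intro nn_integral_cong) (auto simp: indicator_def mem_Times_iff)
      also have "\<dots> = emeasure (r z) E * indicator (M \<times> N) z"
        unfolding nn_integral_cmult_indicator[OF Ez] by (rule mult.commute)
      finally show "(\<integral>\<^sup>+ t. indicator (M \<times> N \<times> E) (fst z, snd z, t) \<partial>r z) = emeasure (r z) E * indicator (M \<times> N) z" .
    qed
    also have "\<dots> = (\<integral>\<^sup>+ a. \<integral>\<^sup>+ c. emeasure (r (a, c)) E * indicator (M \<times> N) (a, c) \<partial>C \<partial>A)"
      using M N by (intro C.nn_integral_fst[symmetric] borel_measurable_times_ennreal measurable_emeasure_kernel[OF r E]) simp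
    also have "\<dots> = (\<integral>\<^sup>+ a\<in>M. (\<integral>\<^sup>+ c\<in>N. emeasure (r (a, c)) E \<partial>C) \<partial>A)"
      by (intro nn_integral_cong) (auto simp: indicator_def split: if_splits)
    finally show ?thesis .
  qed
  have space_R: "space R = space A \<times> space C \<times> {0<..}"
    by (simp add: R_def space_pair_measure)
  have "distr R A (\<lambda>(a, c, t). a) = A"
  proof (rule measure_eqI)
    fix M assume "M \<in> sets (distr R A (\<lambda>(a, c, t). a))"
    then have M: "M \<in> sets A" by simp
    have "(\<lambda>(a, c, t). a) \<in> R \<rightarrow>\<^sub>M A"
      unfolding measurable_cong_sets[OF sets_R refl] by measurable
    then have "emeasure (distr R A (\<lambda>(a, c, t). a)) M = emeasure R ((\<lambda>(a, c, t). a) -` M \<inter> space R)"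
      by (rule emeasure_distr[OF _ M])
    also have "(\<lambda>(a, c, t). a) -` M \<inter> space R = M \<times> space C \<times> {0<..}"
      using sets.sets_into_space[OF M] by (auto simp: space_R)
    also have "emeasure R (M \<times> space C \<times> {0<..}) = (\<integral>\<^sup>+ a\<in>M. (\<integral>\<^sup>+ c. emeasure (r (a, c)) {0<..} \<partial>C) \<partial>A)"
      unfolding box[OF M sets.top sets_Rpos_space] by (intro nn_integral_cong arg_cong2[where f = "(*)"]) auto
    also have "\<dots> = (\<integral>\<^sup>+ a. indicator M a \<partial>A)"
      by (rule nn_integral_cong_AE) (use r1 in eventually_elim, simp)
    also have "\<dots> = emeasure A M"
      by (rule nn_integral_indicator[OF M])
    finally show "emeasure (distr R A (\<lambda>(a, c, t). a)) M = emeasure A M" .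
  qed simp
  moreover have "distr (density R (\<lambda>(a, c, t). ennreal t)) C (\<lambda>(a, c, t). c) = C"
  proof (rule measure_eqI)
    fix N assume "N \<in> sets (distr (density R (\<lambda>(a, c, t). ennreal t)) C (\<lambda>(a, c, t). c))"
    then have N: "N \<in> sets C" by simp
    have m1: "(\<lambda>(a, c, t). ennreal t) \<in> borel_measurable ?X"
      by measurable
    have m2: "(\<lambda>(a, c, t). c) \<in> ?X \<rightarrow>\<^sub>M C"
      by measurable
    have m3: "(\<lambda>(a, c, t). ennreal t * indicator N c) \<in> borel_measurable ?X"
      using N by measurable
    have "emeasure (distr (density R (\<lambda>(a, c, t). ennreal t)) C (\<lambda>(a, c, t). c)) N
        = emeasure (density R (\<lambda>(a, c, t). ennreal t)) ((\<lambda>(a, c, t). c) -` N \<inter> space R)"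
      using m2 N by (subst emeasure_distr) (simp_all cong: measurable_cong_sets)
    also have "\<dots> = (\<integral>\<^sup>+ x. (case x of (a, c, t) \<Rightarrow> ennreal t) * indicator ((\<lambda>(a, c, t). c) -` N \<inter> space R) x \<partial>R)"
    proof (rule emeasure_density)
      show "(\<lambda>(a, c, t). ennreal t) \<in> borel_measurable R"
        using m1 by (simp cong: measurable_cong_sets)
      show "(\<lambda>(a, c, t). c) -` N \<inter> space R \<in> sets R"
        using m2 N by (intro measurable_sets[of _ _ C]) (simp_all cong: measurable_cong_sets)
    qed
    also have "\<dots> = (\<integral>\<^sup>+ x. (case x of (a, c, t) \<Rightarrow> ennreal t * indicator N c) \<partial>R)"
      by (intro nn_integral_cong) (auto simp: indicator_def)
    also have "\<dots> = (\<integral>\<^sup>+ z. \<integral>\<^sup>+ t. ennreal t * indicator N (snd z) \<partial>r z \<partial>(A \<Otimes>\<^sub>M C))"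
      using nn_integral_R[OF m3] by simp
    also have "\<dots> = (\<integral>\<^sup>+ z. (\<integral>\<^sup>+ t. ennreal t \<partial>r z) * indicator N (snd z) \<partial>(A \<Otimes>\<^sub>M C))"
      by (intro nn_integral_cong nn_integral_multc borel_measurable_Mtri[OF kernel_in_Mtri[OF r] measurable_ennreal_Rpos])
    also have "\<dots> = (\<integral>\<^sup>+ c. \<integral>\<^sup>+ a. (\<integral>\<^sup>+ t. ennreal t \<partial>r (a, c)) * indicator N (snd (a, c)) \<partial>A \<partial>C)"
      using N by (intro AC.nn_integral_snd[symmetric] borel_measurable_times_ennreal measurable_moment_kernel[OF r]
          measurable_compose[OF measurable_snd borel_measurable_indicator])
    also have "\<dots> = (\<integral>\<^sup>+ c. (\<integral>\<^sup>+ a. \<integral>\<^sup>+ t. ennreal t \<partial>r (a, c) \<partial>A) * indicator N c \<partial>C)"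
      unfolding snd_conv
      by (intro nn_integral_cong nn_integral_multc measurable_compose[OF measurable_Pair2' measurable_moment_kernel[OF r]])
    also have "\<dots> = (\<integral>\<^sup>+ c. indicator N c \<partial>C)"
      by (rule nn_integral_cong_AE) (use r2 in eventually_elim, simp)
    also have "\<dots> = emeasure C N"
      by (rule nn_integral_indicator[OF N])
    finally show "emeasure (distr (density R (\<lambda>(a, c, t). ennreal t)) C (\<lambda>(a, c, t). c)) N = emeasure C N" .
  qed simp
  ultimately have "R \<in> Pol A C"
    by (simp add: Pol_def)
  moreover have "has_pol_density A C R r"
    using r_density box by (simp add: has_pol_density_def)
  ultimately show ?thesis by blast
qed

section \<open>Disintegrations of absolutely continuous polymorphisms\<close>

lemma measure_integral_restrict_in_Mtri:
  assumes k: "k \<in> X \<rightarrow>\<^sub>M Mtri_algebra" and M: "M \<in> sets X" and fin: "measure_integral X k \<in> Mtri"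
  shows "measure_integral (restrict_space X M) k \<in> Mtri"
proof -
  have le: "(\<integral>\<^sup>+ x. f x \<partial>restrict_space X M) \<le> (\<integral>\<^sup>+ x. f x \<partial>X)" for f :: "_ \<Rightarrow> ennreal"
    using M by (subst nn_integral_restrict_space) (auto intro!: nn_integral_mono simp: indicator_def)
  show ?thesis
    using fin unfolding measure_integral_in_Mtri_iff[OF k]
      measure_integral_in_Mtri_iff[OF measurable_restrict_space1[OF k]]
    by (blast intro: le_less_trans[OF le])
qed

lemma measurable_restrict_fst:
  assumes "k \<in> X \<Otimes>\<^sub>M Y \<rightarrow>\<^sub>M Z"
  shows "k \<in> restrict_space X M \<Otimes>\<^sub>M Y \<rightarrow>\<^sub>M Z"
proof -
  have "(\<lambda>z. (fst z, snd z)) \<in> restrict_space X M \<Otimes>\<^sub>M Y \<rightarrow>\<^sub>M X \<Otimes>\<^sub>M Y"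
    using measurable_compose[OF measurable_fst measurable_restrict_space1[OF measurable_ident_sets[OF refl]]]
    by (intro measurable_Pair measurable_snd)
  from measurable_compose[OF this assms] show ?thesis by simp
qed

lemma measurable_restrict_snd:
  assumes "k \<in> X \<Otimes>\<^sub>M Y \<rightarrow>\<^sub>M Z"
  shows "k \<in> X \<Otimes>\<^sub>M restrict_space Y N \<rightarrow>\<^sub>M Z"
proof -
  have "(\<lambda>z. (fst z, snd z)) \<in> X \<Otimes>\<^sub>M restrict_space Y N \<rightarrow>\<^sub>M X \<Otimes>\<^sub>M Y"
    using measurable_compose[OF measurable_snd measurable_restrict_space1[OF measurable_ident_sets[OF refl]]]
    by (intro measurable_Pair measurable_fst)
  from measurable_compose[OF this assms] show ?thesis by simp
qed

lemma set_nn_integral_restrict_space: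
  assumes "M \<in> sets X"
  shows "(\<integral>\<^sup>+ x\<in>M. f x \<partial>X) = (\<integral>\<^sup>+ x. f x \<partial>restrict_space X M)"
  using assms by (simp add: nn_integral_restrict_space)

text \<open>The kernel obtained by integrating out the variable in \<open>M\<close> differs from the plain integral only
  where that integral diverges, hence on a null set.\<close>

lemma emeasure_measure_integral_Mtri_integral:
  assumes X: "sigma_finite_measure X" and k: "k \<in> Y \<Otimes>\<^sub>M X \<rightarrow>\<^sub>M Mtri_algebra"
    and M: "M \<in> sets X" and N: "N \<in> sets Y" and E: "E \<in> sets Rpos"
    and fin: "AE y in Y. measure_integral X (\<lambda>x. k (y, x)) \<in> Mtri"
  shows "emeasure (measure_integral (restrict_space Y N) (\<lambda>y. Mtri_integral (restrict_space X M) (\<lambda>x. k (y, x)))) E =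
    (\<integral>\<^sup>+ y\<in>N. (\<integral>\<^sup>+ x\<in>M. emeasure (k (y, x)) E \<partial>X) \<partial>Y)"
proof -
  have sf: "sigma_finite_measure (restrict_space X M)"
    by (rule sigma_finite_measure_restrict_space[OF X M])
  have f: "(\<lambda>y. Mtri_integral (restrict_space X M) (\<lambda>x. k (y, x))) \<in> restrict_space Y N \<rightarrow>\<^sub>M Mtri_algebra"
    by (rule measurable_restrict_space1[OF measurable_Mtri_integral[OF sf measurable_restrict_snd[OF k]]])
  have "AE y in Y. emeasure (Mtri_integral (restrict_space X M) (\<lambda>x. k (y, x))) E * indicator N y =
      (\<integral>\<^sup>+ x\<in>M. emeasure (k (y, x)) E \<partial>X) * indicator N y"
    using fin
  proof (rule AE_mp, intro AE_I2 impI)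
    fix y assume y: "y \<in> space Y" and "measure_integral X (\<lambda>x. k (y, x)) \<in> Mtri"
    then have "measure_integral (restrict_space X M) (\<lambda>x. k (y, x)) \<in> Mtri"
      by (intro measure_integral_restrict_in_Mtri kernel_section[OF k] M)
    then show "emeasure (Mtri_integral (restrict_space X M) (\<lambda>x. k (y, x))) E * indicator N y =
        (\<integral>\<^sup>+ x\<in>M. emeasure (k (y, x)) E \<partial>X) * indicator N y"
      by (simp add: Mtri_integral_def set_nn_integral_restrict_space[OF M]
          emeasure_measure_integral[OF measurable_restrict_space1[OF kernel_section[OF k y]] E])
  qed
  then show ?thesis
    unfolding emeasure_measure_integral[OF f E] set_nn_integral_restrict_space[OF N, symmetric]
    by (rule nn_integral_cong_AE)
qed

text \<open>The moment of the marginal at \<open>b\<close> is \<open>1\<close> for almost every \<open>b\<close> by the normalisation of moments. Its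
  mass need not be bounded, but by the normalisation of masses its integral over \<open>B\<close> is the total
  mass of \<open>A\<close>, so it is finite almost everywhere.\<close>

lemma AE_left_marginal_in_Mtri:
  assumes A: "finite_measure A" and B: "sigma_finite_measure B" and p_density: "pol_density A B p"
  shows "AE b in B. measure_integral A (\<lambda>a. p (a, b)) \<in> Mtri"
proof -
  interpret A: finite_measure A by (rule A)
  interpret B: sigma_finite_measure B by (rule B)
  interpret pair_sigma_finite A B ..
  have p: "p \<in> A \<Otimes>\<^sub>M B \<rightarrow>\<^sub>M Mtri_algebra"
    and p1: "AE a in A. (\<integral>\<^sup>+ b. emeasure (p (a, b)) {0<..} \<partial>B) = 1"
    and p2: "AE b in B. (\<integral>\<^sup>+ a. \<integral>\<^sup>+ t. ennreal t \<partial>p (a, b) \<partial>A) = 1"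
    using p_density by (auto simp: pol_density_def)
  have m: "(\<lambda>z. emeasure (p z) {0<..}) \<in> borel_measurable (A \<Otimes>\<^sub>M B)"
    by (rule measurable_emeasure_kernel[OF p sets_Rpos_space])
  have "(\<integral>\<^sup>+ b. \<integral>\<^sup>+ a. emeasure (p (a, b)) {0<..} \<partial>A \<partial>B) = (\<integral>\<^sup>+ a. \<integral>\<^sup>+ b. emeasure (p (a, b)) {0<..} \<partial>B \<partial>A)"
    by (rule Fubini[OF m])
  also have "\<dots> = (\<integral>\<^sup>+ a. 1 \<partial>A)"
    by (rule nn_integral_cong_AE[OF p1])
  finally have "(\<integral>\<^sup>+ b. \<integral>\<^sup>+ a. emeasure (p (a, b)) {0<..} \<partial>A \<partial>B) \<noteq> \<infinity>"
    using A.emeasure_finite by simp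
  moreover have "(\<lambda>b. \<integral>\<^sup>+ a. emeasure (p (a, b)) {0<..} \<partial>A) \<in> borel_measurable B"
    using A.borel_measurable_nn_integral_fst[OF measurable_pair_swap[OF m]] by simp
  ultimately have "AE b in B. (\<integral>\<^sup>+ a. emeasure (p (a, b)) {0<..} \<partial>A) \<noteq> \<infinity>"
    by (intro nn_integral_PInf_AE)
  then show ?thesis
    using p2 AE_space
  proof eventually_elim
    case (elim b)
    then show ?case
      by (simp add: measure_integral_in_Mtri_iff[OF measurable_compose[OF measurable_Pair2' p]] less_top)
  qed
qed

text \<open>Here mass and moment exchange roles: the mass is \<open>1\<close> almost everywhere, and the moments integrate
  to the total mass of \<open>C\<close>.\<close>

lemma AE_right_marginal_in_Mtri:
  assumes B: "sigma_finite_measure B" and C: "finite_measure C" and q_density: "pol_density B C q"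
  shows "AE b in B. measure_integral C (\<lambda>c. q (b, c)) \<in> Mtri"
proof -
  interpret B: sigma_finite_measure B by (rule B)
  interpret C: finite_measure C by (rule C)
  interpret pair_sigma_finite B C ..
  have q: "q \<in> B \<Otimes>\<^sub>M C \<rightarrow>\<^sub>M Mtri_algebra"
    and q1: "AE b in B. (\<integral>\<^sup>+ c. emeasure (q (b, c)) {0<..} \<partial>C) = 1"
    and q2: "AE c in C. (\<integral>\<^sup>+ b. \<integral>\<^sup>+ t. ennreal t \<partial>q (b, c) \<partial>B) = 1"
    using q_density by (auto simp: pol_density_def)
  have m: "(\<lambda>z. \<integral>\<^sup>+ t. ennreal t \<partial>q z) \<in> borel_measurable (B \<Otimes>\<^sub>M C)"
    by (rule measurable_moment_kernel[OF q])
  have "(\<integral>\<^sup>+ b. \<integral>\<^sup>+ c. \<integral>\<^sup>+ t. ennreal t \<partial>q (b, c) \<partial>C \<partial>B) = (\<integral>\<^sup>+ c. \<integral>\<^sup>+ b. \<integral>\<^sup>+ t. ennreal t \<partial>q (b, c) \<partial>B \<partial>C)"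
    by (rule Fubini[OF m, symmetric])
  also have "\<dots> = (\<integral>\<^sup>+ c. 1 \<partial>C)"
    by (rule nn_integral_cong_AE[OF q2])
  finally have "(\<integral>\<^sup>+ b. \<integral>\<^sup>+ c. \<integral>\<^sup>+ t. ennreal t \<partial>q (b, c) \<partial>C \<partial>B) \<noteq> \<infinity>"
    using C.emeasure_finite by simp
  then have "AE b in B. (\<integral>\<^sup>+ c. \<integral>\<^sup>+ t. ennreal t \<partial>q (b, c) \<partial>C) \<noteq> \<infinity>"
    by (intro nn_integral_PInf_AE C.borel_measurable_nn_integral_fst[OF m])
  then show ?thesis
    using q1 AE_space
  proof eventually_elim
    case (elim b)
    then show ?case
      by (simp add: measure_integral_in_Mtri_iff[OF kernel_section[OF q]] less_top)
  qed
qed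

lemma disintegrates_left_density:
  assumes A: "finite_measure A" and B: "sigma_finite_measure B"
    and P: "has_pol_density A B P p" and M: "M \<in> sets A"
  shows "disintegrates_left B P M (\<lambda>b. Mtri_integral (restrict_space A M) (\<lambda>a. p (a, b)))"
proof -
  interpret A: finite_measure A by (rule A)
  interpret B: sigma_finite_measure B by (rule B)
  have p_density: "pol_density A B p" and sets_P: "sets P = sets (A \<Otimes>\<^sub>M B \<Otimes>\<^sub>M Rpos)"
    and P_box: "\<And>M N E. M \<in> sets A \<Longrightarrow> N \<in> sets B \<Longrightarrow> E \<in> sets Rpos \<Longrightarrow>
      emeasure P (M \<times> N \<times> E) = (\<integral>\<^sup>+ a\<in>M. (\<integral>\<^sup>+ b\<in>N. emeasure (p (a, b)) E \<partial>B) \<partial>A)"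
    using P by (auto simp: has_pol_density_def)
  have p: "p \<in> A \<Otimes>\<^sub>M B \<rightarrow>\<^sub>M Mtri_algebra"
    using p_density by (simp add: pol_density_def)
  have p': "(\<lambda>(b, a). p (a, b)) \<in> B \<Otimes>\<^sub>M A \<rightarrow>\<^sub>M Mtri_algebra"
    by (rule measurable_pair_swap[OF p])
  have A': "sigma_finite_measure (restrict_space A M)"
    by (rule sigma_finite_measure_restrict_space[OF A.sigma_finite_measure_axioms M])
  have "pol_rect P M N = measure_integral (restrict_space B N) (\<lambda>b. Mtri_integral (restrict_space A M) (\<lambda>a. p (a, b)))"
    if N: "N \<in> sets B" for N
  proof (rule measure_eqI)
    fix E assume "E \<in> sets (pol_rect P M N)"
    then have E: "E \<in> sets Rpos" by simp
    interpret A': sigma_finite_measure "restrict_space A M" by (rule A')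
    interpret B': sigma_finite_measure "restrict_space B N"
      by (rule sigma_finite_measure_restrict_space[OF B N])
    interpret pair_sigma_finite "restrict_space A M" "restrict_space B N" ..
    have "emeasure (pol_rect P M N) E =
        (\<integral>\<^sup>+ a. \<integral>\<^sup>+ b. emeasure (p (a, b)) E \<partial>restrict_space B N \<partial>restrict_space A M)"
      by (simp only: emeasure_pol_rect[OF sets_P M N E] P_box[OF M N E]
          set_nn_integral_restrict_space[OF M] set_nn_integral_restrict_space[OF N])
    also have "\<dots> = (\<integral>\<^sup>+ b. \<integral>\<^sup>+ a. emeasure (p (a, b)) E \<partial>restrict_space A M \<partial>restrict_space B N)"
      by (rule Fubini[symmetric])
        (rule measurable_emeasure_kernel[OF measurable_restrict_fst[OF measurable_restrict_snd[OF p]] E])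
    also have "\<dots> = emeasure (measure_integral (restrict_space B N) (\<lambda>b. Mtri_integral (restrict_space A M) (\<lambda>a. p (a, b)))) E"
      using emeasure_measure_integral_Mtri_integral[OF A.sigma_finite_measure_axioms p' M N E]
        AE_left_marginal_in_Mtri[OF A B p_density]
      by (simp add: set_nn_integral_restrict_space[OF M] set_nn_integral_restrict_space[OF N])
    finally show "emeasure (pol_rect P M N) E =
      emeasure (measure_integral (restrict_space B N) (\<lambda>b. Mtri_integral (restrict_space A M) (\<lambda>a. p (a, b)))) E" .
  qed simp
  moreover have "(\<lambda>b. Mtri_integral (restrict_space A M) (\<lambda>a. p (a, b))) \<in> B \<rightarrow>\<^sub>M Mtri_algebra"
    using measurable_Mtri_integral[OF A' measurable_restrict_snd[OF p']] by simp
  ultimately show ?thesis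
    by (simp add: disintegrates_left_def)
qed

lemma disintegrates_right_density:
  assumes B: "sigma_finite_measure B" and C: "finite_measure C"
    and Q: "has_pol_density B C Q q" and K: "K \<in> sets C"
  shows "disintegrates_right B Q K (\<lambda>b. Mtri_integral (restrict_space C K) (\<lambda>c. q (b, c)))"
proof -
  interpret C: finite_measure C by (rule C)
  have q_density: "pol_density B C q" and sets_Q: "sets Q = sets (B \<Otimes>\<^sub>M C \<Otimes>\<^sub>M Rpos)"
    and Q_box: "\<And>N K E. N \<in> sets B \<Longrightarrow> K \<in> sets C \<Longrightarrow> E \<in> sets Rpos \<Longrightarrow>
      emeasure Q (N \<times> K \<times> E) = (\<integral>\<^sup>+ b\<in>N. (\<integral>\<^sup>+ c\<in>K. emeasure (q (b, c)) E \<partial>C) \<partial>B)"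
    using Q by (auto simp: has_pol_density_def)
  have q: "q \<in> B \<Otimes>\<^sub>M C \<rightarrow>\<^sub>M Mtri_algebra"
    using q_density by (simp add: pol_density_def)
  have "pol_rect Q N K = measure_integral (restrict_space B N) (\<lambda>b. Mtri_integral (restrict_space C K) (\<lambda>c. q (b, c)))"
    if N: "N \<in> sets B" for N
  proof (rule measure_eqI)
    fix E assume "E \<in> sets (pol_rect Q N K)"
    then have E: "E \<in> sets Rpos" by simp
    show "emeasure (pol_rect Q N K) E =
      emeasure (measure_integral (restrict_space B N) (\<lambda>b. Mtri_integral (restrict_space C K) (\<lambda>c. q (b, c)))) E"
      unfolding emeasure_pol_rect[OF sets_Q N K E] Q_box[OF N K E]
      by (rule emeasure_measure_integral_Mtri_integral[OF C.sigma_finite_measure_axioms q K N E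
          AE_right_marginal_in_Mtri[OF B C q_density], symmetric])
  qed simp
  moreover have "(\<lambda>b. Mtri_integral (restrict_space C K) (\<lambda>c. q (b, c))) \<in> B \<rightarrow>\<^sub>M Mtri_algebra"
    by (rule measurable_Mtri_integral[OF
        sigma_finite_measure_restrict_space[OF C.sigma_finite_measure_axioms K] measurable_restrict_snd[OF q]])
  ultimately show ?thesis
    by (simp add: disintegrates_right_def)
qed

section \<open>The product of absolutely continuous polymorphisms\<close>

text \<open>With the canonical disintegrations of \<open>P\<close> and \<open>Q\<close>, the convolution at \<open>b\<close> expands by bilinearity
  into an integral over \<open>M \<times> K\<close>, and Tonelli moves the integral over \<open>B\<close> inside, where it becomes the
  density at \<open>(a, c)\<close>.\<close>

lemma is_pol_product_density:
  assumes fin: "finite_measure A" "finite_measure B" "finite_measure C"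
    and P: "has_pol_density A B P p" and Q: "has_pol_density B C Q q"
    and R: "R \<in> Pol A C"
    and R_density: "has_pol_density A C R (\<lambda>(a, c). Mtri_integral B (\<lambda>b. mconv (p (a, b)) (q (b, c))))"
  shows "is_pol_product A B C P Q R"
proof -
  interpret A: finite_measure A by (rule fin)
  interpret B: finite_measure B by (rule fin)
  interpret C: finite_measure C by (rule fin)
  have p_density: "pol_density A B p" and q_density: "pol_density B C q"
    using P Q by (auto simp: has_pol_density_def)
  have p: "p \<in> A \<Otimes>\<^sub>M B \<rightarrow>\<^sub>M Mtri_algebra" and q: "q \<in> B \<Otimes>\<^sub>M C \<rightarrow>\<^sub>M Mtri_algebra"
    using p_density q_density by (auto simp: pol_density_def)
  let ?r = "\<lambda>a c. Mtri_integral B (\<lambda>b. mconv (p (a, b)) (q (b, c)))"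
  have sets_R: "sets R = sets (A \<Otimes>\<^sub>M C \<Otimes>\<^sub>M Rpos)"
    and R_box: "\<And>M K E. M \<in> sets A \<Longrightarrow> K \<in> sets C \<Longrightarrow> E \<in> sets Rpos \<Longrightarrow>
      emeasure R (M \<times> K \<times> E) = (\<integral>\<^sup>+ a\<in>M. (\<integral>\<^sup>+ c\<in>K. emeasure (?r a c) E \<partial>C) \<partial>A)"
    using R_density by (auto simp: has_pol_density_def)
  have "pol_rect R M K = measure_integral B (\<lambda>b.
      mconv (Mtri_integral (restrict_space C K) (\<lambda>c. q (b, c))) (Mtri_integral (restrict_space A M) (\<lambda>a. p (a, b))))"
    if M: "M \<in> sets A" and K: "K \<in> sets C" for M K
  proof (rule measure_eqI)
    fix E assume "E \<in> sets (pol_rect R M K)"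
    then have E: "E \<in> sets Rpos" by simp
    let ?A = "restrict_space A M" and ?C = "restrict_space C K"
    let ?f = "\<lambda>b. Mtri_integral ?A (\<lambda>a. p (a, b))" and ?g = "\<lambda>b. Mtri_integral ?C (\<lambda>c. q (b, c))"
    have A': "sigma_finite_measure ?A" and C': "sigma_finite_measure ?C"
      by (auto intro: sigma_finite_measure_restrict_space A.sigma_finite_measure_axioms C.sigma_finite_measure_axioms M K)
    have p': "p \<in> ?A \<Otimes>\<^sub>M B \<rightarrow>\<^sub>M Mtri_algebra" and q': "q \<in> B \<Otimes>\<^sub>M ?C \<rightarrow>\<^sub>M Mtri_algebra"
      by (rule measurable_restrict_fst[OF p], rule measurable_restrict_snd[OF q])
    have f: "?f \<in> B \<rightarrow>\<^sub>M Mtri_algebra" and g: "?g \<in> B \<rightarrow>\<^sub>M Mtri_algebra"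
      using disintegrates_left_density[OF fin(1) B.sigma_finite_measure_axioms P M]
        disintegrates_right_density[OF B.sigma_finite_measure_axioms fin(3) Q K]
      by (simp_all add: disintegrates_left_def disintegrates_right_def)
    have k: "(\<lambda>((a, c), b). mconv (p (a, b)) (q (b, c))) \<in> (?A \<Otimes>\<^sub>M ?C) \<Otimes>\<^sub>M B \<rightarrow>\<^sub>M Mtri_algebra"
      by (rule measurable_composition_kernel[OF p' q'])
    have "AE a in ?A. AE c in ?C. measure_integral B (\<lambda>b. mconv (p (a, b)) (q (b, c))) \<in> Mtri"
      using AE_composition_in_Mtri[OF fin p_density q_density] M K
      by (simp add: AE_restrict_space_iff) (auto elim: eventually_mono)
    then have r: "AE a in ?A. (\<integral>\<^sup>+ c. emeasure (?r a c) E \<partial>?C) =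
        (\<integral>\<^sup>+ c. \<integral>\<^sup>+ b. emeasure (mconv (p (a, b)) (q (b, c))) E \<partial>B \<partial>?C)"
    proof (rule AE_mp, intro AE_I2 impI)
      fix a assume a: "a \<in> space ?A"
        and *: "AE c in ?C. measure_integral B (\<lambda>b. mconv (p (a, b)) (q (b, c))) \<in> Mtri"
      show "(\<integral>\<^sup>+ c. emeasure (?r a c) E \<partial>?C) = (\<integral>\<^sup>+ c. \<integral>\<^sup>+ b. emeasure (mconv (p (a, b)) (q (b, c))) E \<partial>B \<partial>?C)"
      proof (rule nn_integral_cong_AE, rule AE_mp[OF *], intro AE_I2 impI)
        fix c assume c: "c \<in> space ?C" and **: "measure_integral B (\<lambda>b. mconv (p (a, b)) (q (b, c))) \<in> Mtri"
        have "(\<lambda>b. mconv (p (a, b)) (q (b, c))) \<in> B \<rightarrow>\<^sub>M Mtri_algebra"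
          by (rule measurable_mconv[OF kernel_section[OF p' a] measurable_compose[OF measurable_Pair2'[OF c] q']])
        with ** show "emeasure (?r a c) E = (\<integral>\<^sup>+ b. emeasure (mconv (p (a, b)) (q (b, c))) E \<partial>B)"
          by (simp add: Mtri_integral_def emeasure_measure_integral E)
      qed
    qed
    have fg: "AE b in B. emeasure (mconv (?g b) (?f b)) E =
        (\<integral>\<^sup>+ a. \<integral>\<^sup>+ c. emeasure (mconv (p (a, b)) (q (b, c))) E \<partial>?C \<partial>?A)"
      using AE_left_marginal_in_Mtri[OF fin(1) B.sigma_finite_measure_axioms p_density]
        AE_right_marginal_in_Mtri[OF B.sigma_finite_measure_axioms fin(3) q_density]
    proof (rule AE_mp[OF _ AE_mp], intro AE_I2 impI)
      fix b assume b: "b \<in> space B" and "measure_integral C (\<lambda>c. q (b, c)) \<in> Mtri"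
        and "measure_integral A (\<lambda>a. p (a, b)) \<in> Mtri"
      then have int: "measure_integral ?A (\<lambda>a. p (a, b)) \<in> Mtri" "measure_integral ?C (\<lambda>c. q (b, c)) \<in> Mtri"
        by (auto intro!: measure_integral_restrict_in_Mtri M K kernel_section[OF q]
            measurable_compose[OF measurable_Pair2' p])
      have "emeasure (mconv (?g b) (?f b)) E = emeasure (mconv (?f b) (?g b)) E"
        by (intro arg_cong[where f = "\<lambda>\<mu>. emeasure \<mu> E"] mconv_commute Mtri_integral_in_Mtri)
      also have "\<dots> = emeasure (mconv (measure_integral ?A (\<lambda>a. p (a, b))) (measure_integral ?C (\<lambda>c. q (b, c)))) E"
        using int by (simp add: Mtri_integral_def)
      also have "\<dots> = (\<integral>\<^sup>+ a. \<integral>\<^sup>+ c. emeasure (mconv (p (a, b)) (q (b, c))) E \<partial>?C \<partial>?A)"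
        by (rule mconv_measure_integral[OF measurable_compose[OF measurable_Pair2'[OF b] p']
            kernel_section[OF q' b] C' int E])
      finally show "emeasure (mconv (?g b) (?f b)) E =
        (\<integral>\<^sup>+ a. \<integral>\<^sup>+ c. emeasure (mconv (p (a, b)) (q (b, c))) E \<partial>?C \<partial>?A)" .
    qed
    have "emeasure (pol_rect R M K) E = (\<integral>\<^sup>+ a. \<integral>\<^sup>+ c. emeasure (?r a c) E \<partial>?C \<partial>?A)"
      by (simp only: emeasure_pol_rect[OF sets_R M K E] R_box[OF M K E]
          set_nn_integral_restrict_space[OF M] set_nn_integral_restrict_space[OF K])
    also have "\<dots> = (\<integral>\<^sup>+ a. \<integral>\<^sup>+ c. \<integral>\<^sup>+ b. emeasure (mconv (p (a, b)) (q (b, c))) E \<partial>B \<partial>?C \<partial>?A)"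
      by (rule nn_integral_cong_AE[OF r])
    also have "\<dots> = (\<integral>\<^sup>+ b. \<integral>\<^sup>+ a. \<integral>\<^sup>+ c. emeasure (mconv (p (a, b)) (q (b, c))) E \<partial>?C \<partial>?A \<partial>B)"
      using nn_integral_rotate[OF A' B.sigma_finite_measure_axioms C' measurable_emeasure_kernel[OF k E]]
      by simp
    also have "\<dots> = (\<integral>\<^sup>+ b. emeasure (mconv (?g b) (?f b)) E \<partial>B)"
      by (rule nn_integral_cong_AE[OF fg, symmetric])
    also have "\<dots> = emeasure (measure_integral B (\<lambda>b. mconv (?g b) (?f b))) E"
      by (rule emeasure_measure_integral[OF measurable_mconv[OF g f] E, symmetric])
    finally show "emeasure (pol_rect R M K) E = emeasure (measure_integral B (\<lambda>b. mconv (?g b) (?f b))) E" .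
  qed simp
  then show ?thesis
    unfolding is_pol_product_def
    using R disintegrates_left_density[OF fin(1) B.sigma_finite_measure_axioms P]
      disintegrates_right_density[OF B.sigma_finite_measure_axioms fin(3) Q]
    by blast
qed

theorem lemma5p4:
  fixes A :: "'a measure" and B :: "'b measure" and C :: "'c measure"
    and P :: "('a \<times> 'b \<times> real) measure" and Q :: "('b \<times> 'c \<times> real) measure"
    and p :: "'a \<times> 'b \<Rightarrow> real measure" and q :: "'b \<times> 'c \<Rightarrow> real measure"
  assumes "lebesgue_space A" and "lebesgue_space B" and "lebesgue_space C"
    and "P \<in> Pol A B" and "Q \<in> Pol B C"
    and "has_pol_density A B P p" and "has_pol_density B C Q q"
  shows "has_pol_density A C (pol_product A B C Q P)
           (\<lambda>(a, c). Mtri_integral B (\<lambda>b. mconv (p (a, b)) (q (b, c))))"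
proof -
  have fin: "finite_measure A" "finite_measure B" "finite_measure C"
    using assms(1-3) by (auto simp: lebesgue_space_def)
  have sets: "sets P = sets (A \<Otimes>\<^sub>M B \<Otimes>\<^sub>M Rpos)" "sets Q = sets (B \<Otimes>\<^sub>M C \<Otimes>\<^sub>M Rpos)"
    using assms(4,5) by (auto simp: Pol_def)
  have "pol_density A C (\<lambda>(a, c). Mtri_integral B (\<lambda>b. mconv (p (a, b)) (q (b, c))))"
    using assms(6,7) by (intro pol_density_composition fin) (auto simp: has_pol_density_def)
  then obtain R where R: "R \<in> Pol A C"
      "has_pol_density A C R (\<lambda>(a, c). Mtri_integral B (\<lambda>b. mconv (p (a, b)) (q (b, c))))"
    using ex_polymorphism_with_density[OF fin(1,3)] by blast
  have R_product: "is_pol_product A B C P Q R"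
    by (rule is_pol_product_density[OF fin assms(6,7) R])
  have "pol_product A B C Q P = R"
    unfolding pol_product_def
  proof (rule the_equality, rule R_product)
    fix R' assume "is_pol_product A B C P Q R'"
    then show "R' = R"
      using R_product fin(1) finite_measure_Pol[OF assms(4) fin(1)] finite_measure_Pol[OF assms(5) fin(2)] sets
      by (rule is_pol_product_unique)
  qed
  with R(2) show ?thesis by simp
qed

end
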